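(* If MDSC admits an $\alpha$-approximation algorithm, then for every $0<\varepsilon<1$ the PSMC problem admits an $\left(\alpha\left(1+\ln\frac1\varepsilon+\frac{1-q}{\varepsilon q}\right),\,1-\varepsilon\right)$-bicriteria approximation algorithm; that is, one obtains a sub-collection $\mathcal F\subseteq\mathcal S$ with $c(\mathcal F)\le \alpha\left(1+\ln\frac1\varepsilon+\frac{1-q}{\varepsilon q}\right)opt$ and $|\mathcal C(\mathcal F)|\ge(1-\varepsilon)qn$, where $opt$ is the optimal PSMC cost.
   Context: For $\mathcal S'\subseteq\mathcal S$ and $e\in E$, $\mathcal S'_e=\{S\in\mathcal S'\colon e\in S\}$; $e$ is fully covered by $\mathcal S'$ if $|\mathcal S'_e|\ge r_e$; $\mathcal C(\mathcal S')$ is the set of elements fully covered by $\mathcal S'$; $c(\mathcal S')=\sum_{S\in\mathcal S'}c_S$. PSMC: given element set $E$ with $|E|=n$, collection $\mathcal S\subseteq 2^E$, nonnegative costs $c_S$, positive integer requirements $r_e$, and a constant $0<q<1$, find a minimum-cost $\mathcal S'\subseteq\mathcal S$ with $|\mathcal C(\mathcal S')|\ge qn$; $opt$ denotes its optimal cost. MDSC: given $(E,\mathcal S,c,r)$, find $\mathcal S'\subseteq\mathcal S$ minimizing the density $c(\mathcal S')/|\mathcal C(\mathcal S')|$; an $\alpha$-approximation algorithm returns a sub-collection of density at most $\alpha$ times the minimum. *)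

theory Defs
  imports Complex_Main "HOL-Library.Extended_Real" "HOL-Computational_Algebra.Polynomial"
begin

section \<open>Set multicover\<close>

definition smc_instance ::
    "'a set \<Rightarrow> 'a set set \<Rightarrow> ('a set \<Rightarrow> real) \<Rightarrow> ('a \<Rightarrow> nat) \<Rightarrow> bool" where
  "smc_instance E \<S> c r \<longleftrightarrow>
     finite E \<and> \<S> \<subseteq> Pow E \<and> (\<forall>S\<in>\<S>. 0 \<le> c S) \<and> (\<forall>e\<in>E. 0 < r e)"

definition covering :: "'a set set \<Rightarrow> 'a \<Rightarrow> 'a set set" where
  "covering \<F> e = {S \<in> \<F>. e \<in> S}"

definition fully_covered :: "'a set \<Rightarrow> ('a \<Rightarrow> nat) \<Rightarrow> 'a set set \<Rightarrow> 'a set" where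
  "fully_covered E r \<F> = {e \<in> E. r e \<le> card (covering \<F> e)}"

definition cost :: "('a set \<Rightarrow> real) \<Rightarrow> 'a set set \<Rightarrow> real" where
  "cost c \<F> = (\<Sum>S\<in>\<F>. c S)"

text \<open>A sub-collection that fully covers nothing has density \<open>\<infinity>\<close>
  (and not \<open>x / 0 = 0\<close>, which would make the empty sub-collection optimal).\<close>

definition density ::
    "'a set \<Rightarrow> ('a set \<Rightarrow> real) \<Rightarrow> ('a \<Rightarrow> nat) \<Rightarrow> 'a set set \<Rightarrow> ereal" where
  "density E c r \<F> =
     (if fully_covered E r \<F> = {} then \<infinity>
      else ereal (cost c \<F> / real (card (fully_covered E r \<F>))))"

definition min_density ::
    "'a set \<Rightarrow> 'a set set \<Rightarrow> ('a set \<Rightarrow> real) \<Rightarrow> ('a \<Rightarrow> nat) \<Rightarrow> ereal" where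
  "min_density E \<S> c r = Min (density E c r ` Pow \<S>)"

definition psmc_feasible ::
    "real \<Rightarrow> 'a set \<Rightarrow> 'a set set \<Rightarrow> ('a \<Rightarrow> nat) \<Rightarrow> 'a set set set" where
  "psmc_feasible q E \<S> r =
     {\<F>. \<F> \<subseteq> \<S> \<and> q * real (card E) \<le> real (card (fully_covered E r \<F>))}"

definition psmc_opt ::
    "real \<Rightarrow> 'a set \<Rightarrow> 'a set set \<Rightarrow> ('a set \<Rightarrow> real) \<Rightarrow> ('a \<Rightarrow> nat) \<Rightarrow> real" where
  "psmc_opt q E \<S> c r = Min (cost c ` psmc_feasible q E \<S> r)"


section \<open>Algorithms\<close>

text \<open>Costs and the parameters \<open>q\<close>, \<open>\<epsilon>\<close> are arbitrary reals, so the machine model is the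
  unit-cost real-number model (Blum, Shub and Smale), presented as a structured \<open>WHILE\<close> language
  over binary trees (Jones) whose leaves may carry reals. Reals can be combined by field
  operations and compared; there is no rounding. A program is a fixed finite text, so its
  expressions have bounded size and charging one step per assignment and per test
  agrees up to a constant factor with charging per operation.\<close>

datatype val = VNil | VNum real | VCons val val

primrec val_size :: "val \<Rightarrow> nat" where
  "val_size VNil = 1"
| "val_size (VNum x) = 1"
| "val_size (VCons v w) = 1 + val_size v + val_size w"

text \<open>Operations applied to a value of the wrong shape return a default.\<close>

fun val_hd :: "val \<Rightarrow> val" where
  "val_hd (VCons v w) = v"
| "val_hd _ = VNil"

fun val_tl :: "val \<Rightarrow> val" where
  "val_tl (VCons v w) = w"
| "val_tl _ = VNil"

fun val_num :: "val \<Rightarrow> real" where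
  "val_num (VNum x) = x"
| "val_num _ = 0"

datatype expr =
    Var nat
  | NilE
  | Const real
  | ConsE expr expr
  | Hd expr
  | Tl expr
  | Plus expr expr
  | Minus expr expr
  | Times expr expr
  | Divide expr expr

datatype test =
    IsNil expr
  | IsNum expr
  | Less expr expr

datatype com =
    Assign nat expr
  | Seq com com
  | If test com com
  | While test com

type_synonym state = "nat \<Rightarrow> val"

primrec eval :: "expr \<Rightarrow> state \<Rightarrow> val" where
  "eval (Var x) s = s x"
| "eval NilE s = VNil"
| "eval (Const a) s = VNum a"
| "eval (ConsE e f) s = VCons (eval e s) (eval f s)"
| "eval (Hd e) s = val_hd (eval e s)"
| "eval (Tl e) s = val_tl (eval e s)"
| "eval (Plus e f) s = VNum (val_num (eval e s) + val_num (eval f s))"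
| "eval (Minus e f) s = VNum (val_num (eval e s) - val_num (eval f s))"
| "eval (Times e f) s = VNum (val_num (eval e s) * val_num (eval f s))"
| "eval (Divide e f) s = VNum (val_num (eval e s) / val_num (eval f s))"

primrec holds :: "test \<Rightarrow> state \<Rightarrow> bool" where
  "holds (IsNil e) s \<longleftrightarrow> eval e s = VNil"
| "holds (IsNum e) s \<longleftrightarrow> (\<exists>x. eval e s = VNum x)"
| "holds (Less e f) s \<longleftrightarrow> val_num (eval e s) < val_num (eval f s)"

text \<open>\<open>exec C s t s'\<close>: started in state \<open>s\<close>, the program \<open>C\<close> halts after exactly \<open>t\<close> steps
  in state \<open>s'\<close>.\<close>

inductive exec :: "com \<Rightarrow> state \<Rightarrow> nat \<Rightarrow> state \<Rightarrow> bool" where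
  Assign: "exec (Assign x e) s 1 (s(x := eval e s))"
| Seq: "exec C s t s' \<Longrightarrow> exec D s' u s'' \<Longrightarrow> exec (Seq C D) s (t + u) s''"
| IfTrue: "holds b s \<Longrightarrow> exec C s t s' \<Longrightarrow> exec (If b C D) s (1 + t) s'"
| IfFalse: "\<not> holds b s \<Longrightarrow> exec D s t s' \<Longrightarrow> exec (If b C D) s (1 + t) s'"
| WhileFalse: "\<not> holds b s \<Longrightarrow> exec (While b C) s 1 s"
| WhileTrue: "holds b s \<Longrightarrow> exec C s t s' \<Longrightarrow> exec (While b C) s' u s'' \<Longrightarrow>
    exec (While b C) s (1 + t + u) s''"

lemma exec_deterministic:
  "exec C s t s' \<Longrightarrow> exec C s u s'' \<Longrightarrow> t = u \<and> s' = s''"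
proof (induction arbitrary: u s'' rule: exec.induct)
  case (Assign x e s)
  then show ?case by (auto elim: exec.cases)
next
  case (Seq C s t s' D v s1)
  from Seq.prems show ?case
    by (cases rule: exec.cases) (use Seq.IH in blast)
next
  case (IfTrue b s C t s' D)
  from IfTrue.prems IfTrue.hyps show ?case
    by (cases rule: exec.cases) (use IfTrue.IH in blast)+
next
  case (IfFalse b s D t s' C)
  from IfFalse.prems IfFalse.hyps show ?case
    by (cases rule: exec.cases) (use IfFalse.IH in blast)+
next
  case (WhileFalse b s C)
  from WhileFalse.prems WhileFalse.hyps show ?case
    by (cases rule: exec.cases) auto
next
  case (WhileTrue b s C t s' v s1)
  from WhileTrue.prems WhileTrue.hyps show ?case
    by (cases rule: exec.cases) (use WhileTrue.IH in blast)+
qed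

text \<open>The input is placed in variable \<open>0\<close>, all other variables start out empty, and the output
  is read off variable \<open>0\<close>.\<close>

definition runs :: "com \<Rightarrow> val \<Rightarrow> nat \<Rightarrow> val \<Rightarrow> bool" where
  "runs C v t w \<longleftrightarrow> (\<exists>s. exec C ((\<lambda>_. VNil)(0 := v)) t s \<and> s 0 = w)"


section \<open>Encoding of inputs and outputs\<close>

definition val_of_list :: "val list \<Rightarrow> val" where
  "val_of_list vs = foldr VCons vs VNil"

definition val_of_bits :: "bool list \<Rightarrow> val" where
  "val_of_bits bs = val_of_list (map (\<lambda>b. VNum (of_bool b)) bs)"

text \<open>\<open>es\<close> and \<open>Ss\<close> enumerate the elements and the collection. The code consists of the list of
  requirements and, for each set, its cost together with its row of the incidence matrix.\<close>

definition val_of_instance ::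
    "'a list \<Rightarrow> 'a set list \<Rightarrow> ('a set \<Rightarrow> real) \<Rightarrow> ('a \<Rightarrow> nat) \<Rightarrow> val" where
  "val_of_instance es Ss c r =
     VCons (val_of_list (map (\<lambda>e. VNum (real (r e))) es))
       (val_of_list (map (\<lambda>S. VCons (VNum (c S)) (val_of_bits (map (\<lambda>e. e \<in> S) es))) Ss))"

text \<open>A sub-collection is output as its characteristic vector along \<open>Ss\<close>.\<close>

definition selected :: "'a set list \<Rightarrow> bool list \<Rightarrow> 'a set set" where
  "selected Ss bs = {Ss ! i | i. i < length Ss \<and> bs ! i}"


section \<open>Polynomial-time approximation algorithms\<close>

definition MDSC_approx_alg :: "real \<Rightarrow> com \<Rightarrow> bool" where
  "MDSC_approx_alg \<alpha> A \<longleftrightarrow>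
     (\<exists>p :: nat poly. \<forall>(es :: nat list) Ss c r.
        distinct es \<and> distinct Ss \<and> smc_instance (set es) (set Ss) c r \<longrightarrow>
        (\<exists>t bs.
           runs A (val_of_instance es Ss c r) t (val_of_bits bs) \<and>
           t \<le> poly p (val_size (val_of_instance es Ss c r)) \<and>
           length bs = length Ss \<and>
           density (set es) c r (selected Ss bs)
             \<le> ereal \<alpha> * min_density (set es) (set Ss) c r))"

text \<open>The number \<open>q\<close> is part of the input, and the cost ratio \<open>\<beta>\<close> may depend on it. On an
  instance without feasible solution, \<open>opt\<close> is undefined and the algorithm only has to
  stop in polynomial time with some sub-collection.\<close>

definition PSMC_bicriteria_alg :: "(real \<Rightarrow> real) \<Rightarrow> real \<Rightarrow> com \<Rightarrow> bool" where
  "PSMC_bicriteria_alg \<beta> \<gamma> A \<longleftrightarrow>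
     (\<exists>p :: nat poly. \<forall>q (es :: nat list) Ss c r.
        0 < q \<and> q < 1 \<and>
        distinct es \<and> distinct Ss \<and> smc_instance (set es) (set Ss) c r \<longrightarrow>
        (\<exists>t bs.
           runs A (VCons (VNum q) (val_of_instance es Ss c r)) t (val_of_bits bs) \<and>
           t \<le> poly p (val_size (VCons (VNum q) (val_of_instance es Ss c r))) \<and>
           length bs = length Ss \<and>
           (psmc_feasible q (set es) (set Ss) r \<noteq> {} \<longrightarrow>
              cost c (selected Ss bs) \<le> \<beta> q * psmc_opt q (set es) (set Ss) c r \<and>
              \<gamma> * q * real (card (set es))
                \<le> real (card (fully_covered (set es) r (selected Ss bs))))))"

end

theory Submission
  imports Defs
begin

text \<open>Repeatedly run the given algorithm on a residual instance and add the sets it returns to the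
  current collection \<open>\<F>\<close>, as long as fewer than \<open>(1 - \<epsilon>) q n\<close> elements are covered. In the residual
  instance the sets of \<open>\<F>\<close> are free and the elements already covered do not count.
  If \<open>\<F>\<close> covers \<open>a\<close> elements, then an optimal solution together with \<open>\<F>\<close> has residual density at most
  \<open>opt / (q n - a)\<close>, so a round that raises \<open>a\<close> to \<open>b\<close> costs at most \<open>\<alpha> opt (b - a) / (q n - a)\<close>.
  The rounds that stay below the threshold telescope to at most \<open>\<alpha> opt ln (1 / \<epsilon>)\<close>, and the last
  round, where \<open>b \<le> n\<close> and \<open>q n - a > \<epsilon> q n\<close>, costs at most \<open>\<alpha> opt (1 + (1 - q) / (\<epsilon> q))\<close>.
  Every round covers a new element, so \<open>n\<close> rounds suffice.\<close>

section \<open>Time-bounded execution\<close>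

text \<open>Total correctness with a step bound. Execution is deterministic, so the run claimed to
  exist is the only one.\<close>

definition halts_within :: "com \<Rightarrow> state \<Rightarrow> nat \<Rightarrow> (state \<Rightarrow> bool) \<Rightarrow> bool" where
  "halts_within C s T P \<longleftrightarrow> (\<exists>t s'. exec C s t s' \<and> t \<le> T \<and> P s')"

lemma halts_within_mono:
  "halts_within C s T P \<Longrightarrow> T \<le> U \<Longrightarrow> (\<And>s'. P s' \<Longrightarrow> P' s') \<Longrightarrow> halts_within C s U P'"
  unfolding halts_within_def by (meson le_trans)

lemma halts_within_Assign [simp]:
  "halts_within (Assign x e) s T P \<longleftrightarrow> 1 \<le> T \<and> P (s(x := eval e s))"
  unfolding halts_within_def by (metis exec.Assign exec_deterministic)

lemma halts_within_Seq:
  assumes "halts_within C s T P" and "\<And>s'. P s' \<Longrightarrow> halts_within D s' U P'"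
  shows "halts_within (Seq C D) s (T + U) P'"
  using assms unfolding halts_within_def by (meson add_le_mono exec.Seq)

text \<open>An equivalence, so that straight-line code can be rewritten into state updates that
  consume one step each. The forward direction rests on determinism.\<close>

lemma halts_within_Seq_Assign [simp]:
  "halts_within (Seq (Assign x e) D) s T P \<longleftrightarrow>
     1 \<le> T \<and> halts_within D (s(x := eval e s)) (T - 1) P"
proof
  assume "halts_within (Seq (Assign x e) D) s T P"
  then obtain t s' where "exec (Seq (Assign x e) D) s t s'" "t \<le> T" "P s'"
    unfolding halts_within_def by blast
  then obtain a b s1 where "exec (Assign x e) s a s1" "exec D s1 b s'" "t = a + b"
    by (auto elim: exec.cases)
  with \<open>t \<le> T\<close> \<open>P s'\<close> exec_deterministic[OF this(1) exec.Assign]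
  show "1 \<le> T \<and> halts_within D (s(x := eval e s)) (T - 1) P"
    unfolding halts_within_def by force
next
  assume "1 \<le> T \<and> halts_within D (s(x := eval e s)) (T - 1) P"
  then show "halts_within (Seq (Assign x e) D) s T P"
    using halts_within_Seq[of "Assign x e" s 1 "\<lambda>s'. s' = s(x := eval e s)" D "T - 1" P] by simp
qed

lemma halts_within_If:
  assumes "holds b s \<Longrightarrow> halts_within C s T P" "\<not> holds b s \<Longrightarrow> halts_within D s T P"
  shows "halts_within (If b C D) s (Suc T) P"
  using assms unfolding halts_within_def
  by (metis IfFalse IfTrue Suc_le_mono plus_1_eq_Suc)

text \<open>\<open>I ys zs\<close> describes the state when \<open>ys\<close> has been processed and \<open>zs\<close> remains.\<close>

lemma halts_within_While:
  assumes step: "\<And>ys z zs s. xs = ys @ z # zs \<Longrightarrow> I ys (z # zs) s \<Longrightarrow>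
      holds b s \<and> halts_within C s T (I (ys @ [z]) zs)"
    and stop: "\<And>s. I xs [] s \<Longrightarrow> \<not> holds b s"
    and "I [] xs s"
  shows "halts_within (While b C) s (Suc (length xs * Suc T)) (I xs [])"
proof -
  \<comment> \<open>Each entry pays for one body and one successful test; the outer
    \<open>Suc\<close> pays for the final failing test.\<close>
  have "halts_within (While b C) s (Suc (length zs * Suc T)) (I xs [])"
    if "xs = ys @ zs" "I ys zs s" for ys zs s
    using that
  proof (induction zs arbitrary: ys s)
    case Nil
    then show ?case
      using stop[of s] WhileFalse[of b s C] unfolding halts_within_def by auto
  next
    case (Cons z zs)
    from step[OF Cons.prems] obtain t s1
      where 1: "holds b s" "exec C s t s1" "t \<le> T" "I (ys @ [z]) zs s1"
      unfolding halts_within_def by blast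
    from Cons.IH[of "ys @ [z]" s1] 1(4) Cons.prems(1) obtain u s2
      where 2: "exec (While b C) s1 u s2" "u \<le> Suc (length zs * Suc T)" "I xs [] s2"
      unfolding halts_within_def by auto
    from WhileTrue[OF 1(1,2) 2(1)] have "exec (While b C) s (1 + t + u) s2" .
    moreover have "1 + t + u \<le> Suc (length (z # zs) * Suc T)" using 1 2 by simp
    ultimately show ?case using 2(3) unfolding halts_within_def by blast
  qed
  from this[of "[]" xs s] assms(3) show ?thesis by simp
qed

section \<open>Encoded lists and a loop that maps a function over them\<close>

lemma val_of_list_simps [simp]:
  "val_of_list [] = VNil" "val_of_list (v # vs) = VCons v (val_of_list vs)"
  by (simp_all add: val_of_list_def)

lemma val_of_bits_simps [simp]:
  "val_of_bits [] = VNil" "val_of_bits (b # bs) = VCons (VNum (of_bool b)) (val_of_bits bs)"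
  by (simp_all add: val_of_bits_def)

text \<open>Tests cannot be negated, so nonemptiness is recognized by a number \<open>h\<close>
  found in the first entry; on the empty list \<open>val_hd\<close> defaults to \<open>VNil\<close>,
  which ends the loop. Consing the results reverses the order.\<close>

definition rev_map_loop :: "expr \<Rightarrow> nat \<Rightarrow> expr \<Rightarrow> nat \<Rightarrow> com" where
  "rev_map_loop h x e y =
     While (IsNum h) (Seq (Assign y (ConsE e (Var y))) (Assign x (Tl (Var x))))"

lemma rev_map_loop:
  assumes "x \<noteq> y" "s x = val_of_list (map g zs)" "s y = VNil"
    and step: "\<And>s' z w. s' x = VCons (g z) w \<Longrightarrow> z \<in> set zs \<Longrightarrow>
      (\<exists>a. eval h s' = VNum a) \<and> eval e s' = f z"
    and stop: "\<And>s'. s' x = VNil \<Longrightarrow> eval h s' = VNil"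
  shows "halts_within (rev_map_loop h x e y) s (Suc (3 * length zs))
    (\<lambda>s'. s' = s(x := VNil, y := val_of_list (map f (rev zs))))"
proof -
  let ?I = "\<lambda>ys zs s'. s' = s(x := val_of_list (map g zs), y := val_of_list (map f (rev ys)))"
  have "halts_within (rev_map_loop h x e y) s (Suc (length zs * Suc 2)) (?I zs [])"
    unfolding rev_map_loop_def
  proof (rule halts_within_While)
    fix ys z zs' s' assume a: "zs = ys @ z # zs'" "?I ys (z # zs') s'"
    then have "s' x = VCons (g z) (val_of_list (map g zs'))" using assms(1) by simp
    from step[of s' z, OF this] a(1) have "\<exists>a. eval h s' = VNum a" "eval e s' = f z" by auto
    then show "holds (IsNum h) s' \<and> halts_within (Seq (Assign y (ConsE e (Var y)))
        (Assign x (Tl (Var x)))) s' 2 (?I (ys @ [z]) zs')"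
      using a(2) assms(1) by (auto intro: fun_upd_twist)
  next
    fix s' assume "?I zs [] s'"
    then show "\<not> holds (IsNum h) s'" using stop[of s'] assms(1) by simp
  qed (use assms in \<open>auto simp: fun_eq_iff\<close>)
  then show ?thesis by (simp add: mult.commute)
qed

section \<open>Running a program on a part of the memory\<close>

primrec expr_vars :: "expr \<Rightarrow> nat set" where
  "expr_vars (Var x) = {x}"
| "expr_vars NilE = {}"
| "expr_vars (Const a) = {}"
| "expr_vars (ConsE e f) = expr_vars e \<union> expr_vars f"
| "expr_vars (Hd e) = expr_vars e"
| "expr_vars (Tl e) = expr_vars e"
| "expr_vars (Plus e f) = expr_vars e \<union> expr_vars f"
| "expr_vars (Minus e f) = expr_vars e \<union> expr_vars f"
| "expr_vars (Times e f) = expr_vars e \<union> expr_vars f"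
| "expr_vars (Divide e f) = expr_vars e \<union> expr_vars f"

primrec test_vars :: "test \<Rightarrow> nat set" where
  "test_vars (IsNil e) = expr_vars e"
| "test_vars (IsNum e) = expr_vars e"
| "test_vars (Less e f) = expr_vars e \<union> expr_vars f"

primrec com_vars :: "com \<Rightarrow> nat set" where
  "com_vars (Assign x e) = insert x (expr_vars e)"
| "com_vars (Seq C D) = com_vars C \<union> com_vars D"
| "com_vars (If b C D) = test_vars b \<union> com_vars C \<union> com_vars D"
| "com_vars (While b C) = test_vars b \<union> com_vars C"

text \<open>Supplies the bound \<open>k\<close> above which the greedy program keeps its own
  data.\<close>

lemma finite_com_vars: "finite (com_vars C)"
proof -
  have e: "finite (expr_vars e)" for e by (induction e) auto
  then have "finite (test_vars b)" for b by (cases b) auto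
  with e show ?thesis by (induction C) auto
qed

lemma eval_cong: "(\<And>x. x \<in> expr_vars e \<Longrightarrow> s x = u x) \<Longrightarrow> eval e s = eval e u"
  by (induction e) auto

lemma holds_cong: "(\<And>x. x \<in> test_vars b \<Longrightarrow> s x = u x) \<Longrightarrow> holds b s \<longleftrightarrow> holds b u"
  by (cases b) (auto simp: eval_cong[of _ s u])

text \<open>A run reads and writes only variables of the program. This transfers a run of the given
  algorithm, specified for otherwise empty memory, to a memory that also holds the data of the
  greedy program.\<close>

lemma exec_agree:
  assumes "exec C s t s'" "com_vars C \<subseteq> V" "\<And>x. x \<in> V \<Longrightarrow> s x = u x"
  shows "\<exists>u'. exec C u t u' \<and> (\<forall>x\<in>V. s' x = u' x) \<and> (\<forall>x. x \<notin> V \<longrightarrow> u' x = u x)"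
  using assms
proof (induction arbitrary: u rule: exec.induct)
  case (Assign x e s)
  have "eval e s = eval e u" by (rule eval_cong) (use Assign in auto)
  then show ?case using Assign exec.Assign[of x e u] by (intro exI conjI) auto
next
  case (Seq C s t s' D v s'')
  from Seq.IH(1)[of u] Seq.prems obtain u1 where 1: "exec C u t u1" "\<forall>x\<in>V. s' x = u1 x"
    "\<forall>x. x \<notin> V \<longrightarrow> u1 x = u x" by auto
  from Seq.IH(2)[of u1] Seq.prems 1 obtain u2 where "exec D u1 v u2" "\<forall>x\<in>V. s'' x = u2 x"
    "\<forall>x. x \<notin> V \<longrightarrow> u2 x = u1 x" by auto
  with 1 show ?case by (metis exec.Seq)
next
  case (IfTrue b s C t s' D)
  have "holds b s \<longleftrightarrow> holds b u" by (rule holds_cong) (use IfTrue.prems in auto)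
  then have "holds b u" using IfTrue.hyps by simp
  with IfTrue.IH[of u] IfTrue.prems show ?case
    using exec.IfTrue[of b u C t _ D] by (simp del: plus_1_eq_Suc) blast
next
  case (IfFalse b s D t s' C)
  have "holds b s \<longleftrightarrow> holds b u" by (rule holds_cong) (use IfFalse.prems in auto)
  then have "\<not> holds b u" using IfFalse.hyps by simp
  with IfFalse.IH[of u] IfFalse.prems show ?case
    using exec.IfFalse[of b u D t _ C] by (simp del: plus_1_eq_Suc) blast
next
  case (WhileFalse b s C)
  have "holds b s \<longleftrightarrow> holds b u" by (rule holds_cong) (use WhileFalse.prems in auto)
  then have "\<not> holds b u" using WhileFalse.hyps by simp
  then show ?case using WhileFalse exec.WhileFalse by (intro exI[of _ u]) auto
next
  case (WhileTrue b s C t s' v s'')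
  have "holds b s \<longleftrightarrow> holds b u" by (rule holds_cong) (use WhileTrue.prems in auto)
  then have b: "holds b u" using WhileTrue.hyps by simp
  from WhileTrue.IH(1)[of u] WhileTrue.prems obtain u1 where 1: "exec C u t u1"
    "\<forall>x\<in>V. s' x = u1 x" "\<forall>x. x \<notin> V \<longrightarrow> u1 x = u x" by auto
  from WhileTrue.IH(2)[of u1] WhileTrue.prems 1 obtain u2 where "exec (While b C) u1 v u2"
    "\<forall>x\<in>V. s'' x = u2 x" "\<forall>x. x \<notin> V \<longrightarrow> u2 x = u1 x" by auto
  with 1 b show ?case by (metis exec.WhileTrue)
qed

text \<open>\<open>runs\<close> starts from empty variables; repeated calls have to restore this
  condition.\<close>

primrec clear :: "nat \<Rightarrow> com" where
  "clear 0 = Assign 0 NilE"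
| "clear (Suc n) = Seq (clear n) (Assign (Suc n) NilE)"

lemma halts_within_clear:
  "halts_within (clear n) s (Suc n) (\<lambda>s'. s' = (\<lambda>x. if x \<le> n then VNil else s x))"
proof (induction n)
  case (Suc n)
  from halts_within_Seq[OF Suc, of "Assign (Suc n) NilE" 1] show ?case
    by (auto simp: fun_eq_iff)
qed (auto simp: fun_eq_iff)

text \<open>The argument \<open>e\<close> reads only variables above \<open>k\<close>, so clearing
  the variables up to \<open>k\<close> does not change its value.\<close>

lemma halts_within_call:
  assumes "runs A v t w" "com_vars A \<subseteq> {..k}" "eval e s = v" "expr_vars e \<inter> {..k} = {}"
  shows "halts_within (Seq (clear k) (Seq (Assign 0 e) A)) s (Suc k + Suc t)
    (\<lambda>s'. s' 0 = w \<and> (\<forall>x>k. s' x = s x))"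
proof (rule halts_within_Seq[OF halts_within_clear], unfold halts_within_Seq_Assign, safe)
  let ?s = "\<lambda>x. if x \<le> k then VNil else s x"
  have "eval e ?s = v"
    unfolding assms(3)[symmetric] by (rule eval_cong) (use assms(4) in auto)
  from assms(1) obtain s1 where s1: "exec A ((\<lambda>_. VNil)(0 := v)) t s1" "s1 0 = w"
    unfolding runs_def by blast
  have "((\<lambda>_. VNil)(0 := v)) x = (?s(0 := eval e ?s)) x" if "x \<in> {..k}" for x
    using that \<open>eval e ?s = v\<close> by simp
  from exec_agree[OF s1(1) assms(2) this]
  obtain u where u: "exec A (?s(0 := eval e ?s)) t u" "\<forall>x\<in>{..k}. s1 x = u x"
    "\<forall>x. x \<notin> {..k} \<longrightarrow> u x = (?s(0 := eval e ?s)) x" by blast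
  have "u 0 = w" "\<forall>x>k. u x = s x" using u(2,3) s1(2) by auto
  with u(1) show "halts_within A (?s(0 := eval e ?s)) (Suc t - 1)
      (\<lambda>s'. s' 0 = w \<and> (\<forall>x>k. s' x = s x))"
    unfolding halts_within_def by auto
qed simp

section \<open>The greedy step\<close>

text \<open>A product rather than a case distinction, because the machine computes it arithmetically
  from the 0/1 selection mark.\<close>

definition residual_cost :: "('a set \<Rightarrow> real) \<Rightarrow> 'a set set \<Rightarrow> 'a set \<Rightarrow> real" where
  "residual_cost c \<F> S = c S * (1 - of_bool (S \<in> \<F>))"

text \<open>Already covered elements get an unattainable requirement: deleting them from the ground set
  could identify distinct sets of the collection.\<close>

definition residual_req ::
    "'a set \<Rightarrow> 'a set set \<Rightarrow> ('a \<Rightarrow> nat) \<Rightarrow> 'a set set \<Rightarrow> 'a \<Rightarrow> nat" where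
  "residual_req E \<S> r \<F> e =
     (if e \<in> fully_covered E r \<F> then Suc (card \<S>) else r e)"

lemma smc_instance_residual:
  "smc_instance E \<S> c r \<Longrightarrow>
     smc_instance E \<S> (residual_cost c \<F>) (residual_req E \<S> r \<F>)"
  by (auto simp: smc_instance_def residual_cost_def residual_req_def)

lemma finite_collection: "smc_instance E \<S> c r \<Longrightarrow> finite \<S>"
  by (meson finite_Pow_iff finite_subset smc_instance_def)

lemma cost_nonneg: "smc_instance E \<S> c r \<Longrightarrow> \<F> \<subseteq> \<S> \<Longrightarrow> 0 \<le> cost c \<F>"
  by (auto simp: smc_instance_def cost_def intro!: sum_nonneg)

lemma card_covering_mono:
  "finite \<G> \<Longrightarrow> \<F> \<subseteq> \<G> \<Longrightarrow> card (covering \<F> e) \<le> card (covering \<G> e)"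
  by (intro card_mono) (auto simp: covering_def)

lemma cost_residual:
  assumes "finite \<G>"
  shows "cost (residual_cost c \<F>) \<G> = cost c (\<G> - \<F>)"
proof -
  have "cost (residual_cost c \<F>) \<G> = (\<Sum>S\<in>\<G>. if S \<in> \<F> then 0 else c S)"
    unfolding cost_def by (rule sum.cong) (auto simp: residual_cost_def)
  also have "\<dots> = cost c (\<G> - \<F>)"
    unfolding cost_def using assms by (intro sum.mono_neutral_cong_right) auto
  finally show ?thesis .
qed

text \<open>The comparison solution in the residual instance is \<open>\<O> \<union> \<F>\<close>:
  it costs at most \<open>cost c \<O>\<close> since \<open>\<F>\<close> is free, and it covers at
  least \<open>m\<close> elements that still count. Hence the minimum density is at most
  \<open>cost c \<O> / m\<close>, and \<open>\<G>\<close> pays at most \<alpha> times this per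
  element it covers.\<close>

lemma greedy_step:
  assumes inst: "smc_instance E \<S> c r" and F: "\<F> \<subseteq> \<S>" and G: "\<G> \<subseteq> \<S>" and O: "\<O> \<subseteq> \<S>"
    and m: "0 < m" "m \<le> real (card (fully_covered E r \<O>)) - real (card (fully_covered E r \<F>))"
    and \<alpha>: "0 \<le> \<alpha>"
    and dens: "density E (residual_cost c \<F>) (residual_req E \<S> r \<F>) \<G>
      \<le> ereal \<alpha> * min_density E \<S> (residual_cost c \<F>) (residual_req E \<S> r \<F>)"
  shows "card (fully_covered E r \<F>) < card (fully_covered E r (\<F> \<union> \<G>))"
    and "cost c (\<F> \<union> \<G>) \<le> cost c \<F> + \<alpha> * cost c \<O> *
      (real (card (fully_covered E r (\<F> \<union> \<G>))) - real (card (fully_covered E r \<F>))) / m"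
proof -
  let ?c = "residual_cost c \<F>" and ?r = "residual_req E \<S> r \<F>"
  let ?C = "fully_covered E r"
  note fin = finite_collection[OF inst] finite_subset[OF F] finite_subset[OF G] finite_subset[OF O]
  have finE: "finite E" using inst by (simp add: smc_instance_def)
  have finC: "finite (fully_covered E r' \<H>)" for r' \<H> using finE by (simp add: fully_covered_def)
  \<comment> \<open>Elements not yet covered by \<open>\<F>\<close> keep their requirement, and
    adding \<open>\<F>\<close> to \<open>\<O>\<close> loses no coverage.\<close>
  have sub: "?C \<O> - ?C \<F> \<subseteq> fully_covered E ?r (\<O> \<union> \<F>)"
    using card_covering_mono[of "\<O> \<union> \<F>" \<O>] fin
    by (auto simp: fully_covered_def residual_req_def intro: le_trans)
  have "m \<le> real (card (?C \<O> - ?C \<F>))"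
    using m(2) diff_card_le_card_Diff[OF finC[of r \<F>], of "?C \<O>"] by linarith
  also have "\<dots> \<le> real (card (fully_covered E ?r (\<O> \<union> \<F>)))"
    using card_mono[OF finC sub] by simp
  finally have mle: "m \<le> real (card (fully_covered E ?r (\<O> \<union> \<F>)))" .
  have "cost ?c (\<O> \<union> \<F>) = cost c (\<O> - \<F>)" using fin by (simp add: cost_residual Un_Diff)
  also have "\<dots> \<le> cost c \<O>"
    unfolding cost_def using inst O fin by (intro sum_mono2) (auto simp: smc_instance_def)
  finally have cle: "cost ?c (\<O> \<union> \<F>) \<le> cost c \<O>" .
  have O0: "0 \<le> cost c \<O>" by (rule cost_nonneg[OF inst O])
  have ne: "fully_covered E ?r (\<O> \<union> \<F>) \<noteq> {}" using mle m(1) by auto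
  have "min_density E \<S> ?c ?r \<le> density E ?c ?r (\<O> \<union> \<F>)"
    unfolding min_density_def using fin F O by (intro Min_le) auto
  also have "\<dots> = ereal (cost ?c (\<O> \<union> \<F>) / real (card (fully_covered E ?r (\<O> \<union> \<F>))))"
    using ne by (simp add: density_def)
  also have "\<dots> \<le> ereal (cost c \<O> / m)"
    using cle mle m(1) O0 by (auto intro: frac_le)
  finally have "ereal \<alpha> * min_density E \<S> ?c ?r \<le> ereal \<alpha> * ereal (cost c \<O> / m)"
    using \<alpha> by (intro ereal_mult_left_mono) auto
  with dens have dle: "density E ?c ?r \<G> \<le> ereal (\<alpha> * (cost c \<O> / m))" by simp
  let ?D = "fully_covered E ?r \<G>"
  \<comment> \<open>A finite density bound excludes the value \<infinity> given to sub-collections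
    that cover nothing; this is the progress of the round.\<close>
  have D: "?D \<noteq> {}" using dle by (auto simp: density_def)
  then have Dpos: "0 < card ?D" using finC by (simp add: card_gt_0_iff)
  have "cost ?c \<G> / real (card ?D) \<le> \<alpha> * (cost c \<O> / m)" using dle D by (simp add: density_def)
  then have cG: "cost c (\<G> - \<F>) \<le> \<alpha> * (cost c \<O> / m) * real (card ?D)"
    using Dpos fin G by (simp add: cost_residual pos_divide_le_eq)
  have disj: "?D \<inter> ?C \<F> = {}"
  proof -
    have "card (covering \<G> e) \<le> card \<S>" for e
      using fin G by (intro card_mono) (auto simp: covering_def)
    then show ?thesis by (auto simp: fully_covered_def residual_req_def not_less_eq_eq[symmetric])
  qed
  \<comment> \<open>The inclusion may be strict, since sets of \<open>\<F>\<close> outside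
    \<open>\<G>\<close> can help to cover further elements. This only enlarges the cost
    allowance.\<close>
  have "?D \<union> ?C \<F> \<subseteq> ?C (\<F> \<union> \<G>)"
    using disj card_covering_mono[of "\<F> \<union> \<G>" \<F>] card_covering_mono[of "\<F> \<union> \<G>" \<G>] fin F G
    by (auto simp: fully_covered_def residual_req_def split: if_splits intro: le_trans)
  from card_mono[OF finC this] have "card ?D + card (?C \<F>) \<le> card (?C (\<F> \<union> \<G>))"
    using disj finC by (simp add: card_Un_disjoint)
  then show "card (?C \<F>) < card (?C (\<F> \<union> \<G>))" using Dpos by linarith
  have "cost c (\<F> \<union> \<G>) = cost c \<F> + cost c (\<G> - \<F>)"
    unfolding cost_def using fin F G by (subst sum.union_disjoint[symmetric]) auto
  also have "\<dots> \<le> cost c \<F> + \<alpha> * (cost c \<O> / m) * real (card ?D)" using cG by simp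
  also have "\<dots> \<le> cost c \<F> + \<alpha> * (cost c \<O> / m) *
      (real (card (?C (\<F> \<union> \<G>))) - real (card (?C \<F>)))"
    using \<open>card ?D + card (?C \<F>) \<le> _\<close> \<alpha> O0 m(1)
    by (intro add_left_mono mult_left_mono) auto
  finally show "cost c (\<F> \<union> \<G>) \<le> cost c \<F> + \<alpha> * cost c \<O> *
      (real (card (?C (\<F> \<union> \<G>))) - real (card (?C \<F>))) / m" by simp
qed

text \<open>On one element with a single set of cost 1 the minimum density is 1, while the output
  has density 1 or \<infinity>. The theorem assumes nothing on the sign of \<alpha>, but multiplying
  density bounds by \<alpha> needs it nonnegative.\<close>

lemma MDSC_approx_ratio_ge_1:
  assumes "MDSC_approx_alg \<alpha> A"
  shows "1 \<le> \<alpha>"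
proof -
  let ?c = "\<lambda>_ :: nat set. 1 :: real" and ?r = "\<lambda>_ :: nat. 1 :: nat"
  have inst: "distinct [0 :: nat] \<and> distinct [{0 :: nat}] \<and>
      smc_instance (set [0]) (set [{0}]) ?c ?r" by (simp add: smc_instance_def)
  have Pow: "Pow {{0 :: nat}} = {{}, {{0}}}" by auto
  have d0: "density {0} ?c ?r {} = \<infinity>"
    by (simp add: density_def fully_covered_def covering_def)
  have cov: "covering {{0}} 0 = {{0 :: nat}}" by (auto simp: covering_def)
  have "fully_covered {0} ?r {{0}} = {0}"
    by (intro set_eqI) (simp add: fully_covered_def cov cong: conj_cong)
  then have d1: "density {0} ?c ?r {{0}} = 1"
    by (simp add: density_def cost_def)
  have min: "min_density {0} {{0}} ?c ?r = 1"
    unfolding min_density_def Pow by (simp add: d0 d1 del: One_nat_def)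
  obtain bs where bs:
    "density (set [0]) ?c ?r (selected [{0}] bs) \<le> ereal \<alpha> * min_density (set [0]) (set [{0}]) ?c ?r"
    using assms inst unfolding MDSC_approx_alg_def by metis
  have "selected [{0 :: nat}] bs \<in> Pow {{0}}" by (auto simp: selected_def)
  then consider "selected [{0 :: nat}] bs = {}" | "selected [{0 :: nat}] bs = {{0}}"
    unfolding Pow by blast
  then show ?thesis
  proof cases
    case 1
    with bs have "\<infinity> \<le> ereal \<alpha> * 1" by (simp only: list.set d0 min)
    then show ?thesis by simp
  next
    case 2
    with bs have "1 \<le> ereal \<alpha> * 1" by (simp only: list.set d1 min)
    then show ?thesis by simp
  qed
qed

section \<open>Cost accounting over the rounds\<close>

definition bicriteria_ratio :: "real \<Rightarrow> real \<Rightarrow> real \<Rightarrow> real" where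
  "bicriteria_ratio \<alpha> \<epsilon> q = \<alpha> * (1 + ln (1 / \<epsilon>) + (1 - q) / (\<epsilon> * q))"

text \<open>\<open>j\<close> counts completed rounds. Below the threshold the logarithm is the
  telescoped cost so far, and the lower bound \<open>j\<close> on the number of covered elements
  limits the number of such rounds. At or above the threshold \<open>j\<close> no longer occurs, so
  idle rounds preserve the invariant. Without a feasible solution only
  \<open>\<F> \<subseteq> \<S>\<close> is kept.\<close>

definition greedy_invariant ::
    "real \<Rightarrow> real \<Rightarrow> real \<Rightarrow> 'a set \<Rightarrow> 'a set set \<Rightarrow> ('a set \<Rightarrow> real) \<Rightarrow> ('a \<Rightarrow> nat)
      \<Rightarrow> nat \<Rightarrow> 'a set set \<Rightarrow> bool" where
  "greedy_invariant \<alpha> \<epsilon> q E \<S> c r j \<F> \<longleftrightarrow> \<F> \<subseteq> \<S> \<and> (psmc_feasible q E \<S> r \<noteq> {} \<longrightarrow>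
     (if real (card (fully_covered E r \<F>)) < (1 - \<epsilon>) * q * real (card E)
      then j \<le> card (fully_covered E r \<F>) \<and> cost c \<F> \<le> \<alpha> * psmc_opt q E \<S> c r *
        ln (q * real (card E) / (q * real (card E) - real (card (fully_covered E r \<F>))))
      else cost c \<F> \<le> bicriteria_ratio \<alpha> \<epsilon> q * psmc_opt q E \<S> c r))"

lemma psmc_opt_attained:
  assumes "smc_instance E \<S> c r" "psmc_feasible q E \<S> r \<noteq> {}"
  obtains \<O> where "\<O> \<in> psmc_feasible q E \<S> r" "cost c \<O> = psmc_opt q E \<S> c r"
proof -
  have "psmc_feasible q E \<S> r \<subseteq> Pow \<S>" by (auto simp: psmc_feasible_def)
  then have "finite (psmc_feasible q E \<S> r)"
    using finite_collection[OF assms(1)] by (meson finite_Pow_iff finite_subset)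
  then have "psmc_opt q E \<S> c r \<in> cost c ` psmc_feasible q E \<S> r"
    unfolding psmc_opt_def using assms(2) by (intro Min_in) auto
  then show thesis using that by auto
qed

lemma bicriteria_ratio_nonneg:
  assumes "0 \<le> \<alpha>" "0 < \<epsilon>" "\<epsilon> < 1" "0 < q" "q < 1"
  shows "0 \<le> bicriteria_ratio \<alpha> \<epsilon> q"
  unfolding bicriteria_ratio_def using assms by (intro mult_nonneg_nonneg add_nonneg_nonneg) auto

text \<open>For nonempty \<open>E\<close> the logarithm is ln 1 = 0. An empty \<open>E\<close>
  already meets the threshold, so there the ratio and the optimum must be nonnegative.\<close>

lemma greedy_invariant_start:
  assumes "smc_instance E \<S> c r" "0 \<le> \<alpha>" "0 < \<epsilon>" "\<epsilon> < 1" "0 < q" "q < 1"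
  shows "greedy_invariant \<alpha> \<epsilon> q E \<S> c r 0 {}"
proof -
  have C: "fully_covered E r {} = {}"
    using assms(1) by (auto simp: fully_covered_def covering_def smc_instance_def)
  have "0 \<le> psmc_opt q E \<S> c r" if "psmc_feasible q E \<S> r \<noteq> {}"
    using psmc_opt_attained[OF assms(1) that] cost_nonneg[OF assms(1)]
    by (metis (no_types, lifting) mem_Collect_eq psmc_feasible_def)
  with bicriteria_ratio_nonneg[OF assms(2-)] show ?thesis
    unfolding greedy_invariant_def C by (auto simp: cost_def)
qed

lemma greedy_invariant_skip:
  assumes "greedy_invariant \<alpha> \<epsilon> q E \<S> c r j \<F>"
    and "\<not> real (card (fully_covered E r \<F>)) < (1 - \<epsilon>) * q * real (card E)"
  shows "greedy_invariant \<alpha> \<epsilon> q E \<S> c r i \<F>"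
  using assms by (simp add: greedy_invariant_def)

text \<open>\<open>greedy_step\<close> is applied with an optimal solution as \<open>\<O>\<close>
  and with \<open>m\<close> the gap between q n and the covered elements. Whether the enlarged
  collection is still below the threshold decides which branch of the invariant has to be
  shown.\<close>

lemma greedy_invariant_step:
  assumes inst: "smc_instance E \<S> c r" and \<alpha>: "1 \<le> \<alpha>" and \<epsilon>: "0 < \<epsilon>" "\<epsilon> < 1" and q: "0 < q" "q < 1"
    and inv: "greedy_invariant \<alpha> \<epsilon> q E \<S> c r j \<F>"
    and below: "real (card (fully_covered E r \<F>)) < (1 - \<epsilon>) * q * real (card E)"
    and G: "\<G> \<subseteq> \<S>"
    and dens: "density E (residual_cost c \<F>) (residual_req E \<S> r \<F>) \<G>
      \<le> ereal \<alpha> * min_density E \<S> (residual_cost c \<F>) (residual_req E \<S> r \<F>)"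
  shows "greedy_invariant \<alpha> \<epsilon> q E \<S> c r (Suc j) (\<F> \<union> \<G>)"
proof (cases "psmc_feasible q E \<S> r = {}")
  case True
  with inv G show ?thesis by (simp add: greedy_invariant_def)
next
  case False
  define n where "n = real (card E)"
  define opt where "opt = psmc_opt q E \<S> c r"
  define a where "a = real (card (fully_covered E r \<F>))"
  define b where "b = real (card (fully_covered E r (\<F> \<union> \<G>)))"
  define m where "m = q * n - a"
  from inv False below have F: "\<F> \<subseteq> \<S>" and j: "j \<le> card (fully_covered E r \<F>)"
    and cF: "cost c \<F> \<le> \<alpha> * opt * ln (q * n / m)"
    by (auto simp: greedy_invariant_def n_def opt_def a_def m_def)
  obtain \<O> where O: "\<O> \<in> psmc_feasible q E \<S> r" "cost c \<O> = opt"
    using psmc_opt_attained[OF inst False] unfolding opt_def .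
  have O': "\<O> \<subseteq> \<S>" "q * n \<le> real (card (fully_covered E r \<O>))"
    using O(1) by (auto simp: psmc_feasible_def n_def)
  have opt0: "0 \<le> opt" using cost_nonneg[OF inst O'(1)] O(2) by simp
  have below': "a < (1 - \<epsilon>) * q * n" using below by (simp add: a_def n_def)
  have a0: "0 \<le> a" by (simp add: a_def)
  have "0 < (1 - \<epsilon>) * q * n" using a0 below' by linarith
  then have n: "0 < n" by (cases "card E = 0") (auto simp: n_def)
  \<comment> \<open>This lower bound makes \<open>m\<close> positive and controls both terms in the
    case where the round crosses the threshold.\<close>
  have mgt: "\<epsilon> * q * n < m" using below' by (simp add: m_def algebra_simps)
  have e0: "0 < \<epsilon> * q * n" using \<epsilon> q n by simp
  have m: "0 < m" using mgt e0 by linarith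
  have mle: "m \<le> real (card (fully_covered E r \<O>)) - real (card (fully_covered E r \<F>))"
    using O'(2) by (simp add: m_def a_def)
  have \<alpha>0: "0 \<le> \<alpha>" using \<alpha> by simp
  note step = greedy_step[OF inst F G O'(1) m mle \<alpha>0 dens]
  have ab: "a < b" using step(1) by (simp add: a_def b_def)
  have "cost c (\<F> \<union> \<G>) \<le> cost c \<F> + \<alpha> * opt * (b - a) / m"
    using step(2) by (simp add: O(2) a_def b_def)
  also have "\<dots> \<le> \<alpha> * opt * ln (q * n / m) + \<alpha> * opt * (b - a) / m" using cF by simp
  finally have cFG: "cost c (\<F> \<union> \<G>) \<le> \<alpha> * opt * (ln (q * n / m) + (b - a) / m)"
    by (simp add: algebra_simps)
  have ao: "0 \<le> \<alpha> * opt" using \<alpha> opt0 by simp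
  have qn: "0 < q * n" using q n by simp
  show ?thesis
  proof (cases "b < (1 - \<epsilon>) * q * n")
    case True
    define m' where "m' = q * n - b"
    have m': "0 < m'" using True e0 by (simp add: m'_def algebra_simps)
    \<comment> \<open>The inequality ln x \<le> x - 1 at x = m' / m bounds (b - a) / m by the
      increase of the logarithm, which gives the telescoping.\<close>
    have "ln (m' / m) \<le> m' / m - 1" using m m' by (intro ln_le_minus_one) simp
    also have "\<dots> = (m' - m) / m" using m by (simp add: diff_divide_distrib)
    also have "m' - m = - (b - a)" by (simp add: m_def m'_def)
    finally have "(b - a) / m \<le> ln m - ln m'" using m m' by (simp add: ln_div diff_divide_distrib)
    then have "ln (q * n / m) + (b - a) / m \<le> ln (q * n / m')" 
      using ln_divide_pos[OF qn m] ln_divide_pos[OF qn m'] by linarith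
    then have "cost c (\<F> \<union> \<G>) \<le> \<alpha> * opt * ln (q * n / m')"
      using cFG ao by (meson mult_left_mono order_trans)
    moreover have "Suc j \<le> card (fully_covered E r (\<F> \<union> \<G>))" using step(1) j by linarith
    ultimately show ?thesis
      using F G True by (simp add: greedy_invariant_def n_def b_def m'_def opt_def)
  next
    case False
    have "q * n / m \<le> q * n / (\<epsilon> * q * n)" using mgt e0 qn by (intro divide_left_mono) auto
    also have "\<dots> = 1 / \<epsilon>" using q n \<epsilon> by simp
    finally have "ln (q * n / m) \<le> ln (1 / \<epsilon>)"
      using qn m \<epsilon> by (subst ln_le_cancel_iff) auto
    moreover have "(b - a) / m \<le> 1 + (1 - q) / (\<epsilon> * q)"
    proof -
      have "b \<le> n" unfolding b_def n_def fully_covered_def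
        using inst by (auto intro!: card_mono simp: smc_instance_def)
      then have "(b - a) / m \<le> (n - a) / m" using m by (intro divide_right_mono) auto
      \<comment> \<open>The crossing round may overshoot up to all n elements; the excess over the
        gap \<open>m\<close> is (1 - q) n.\<close>
      also have "\<dots> = (m + (1 - q) * n) / m" by (simp add: m_def algebra_simps)
      also have "\<dots> = 1 + (1 - q) * n / m" using m by (simp add: add_divide_distrib)
      also have "\<dots> \<le> 1 + (1 - q) * n / (\<epsilon> * q * n)"
        using mgt e0 q n by (intro add_left_mono divide_left_mono) auto
      finally show ?thesis using n by simp
    qed
    ultimately have "ln (q * n / m) + (b - a) / m \<le> 1 + ln (1 / \<epsilon>) + (1 - q) / (\<epsilon> * q)"
      by linarith
    then have "cost c (\<F> \<union> \<G>) \<le> \<alpha> * opt * (1 + ln (1 / \<epsilon>) + (1 - q) / (\<epsilon> * q))"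
      using cFG ao by (meson mult_left_mono order_trans)
    then have "cost c (\<F> \<union> \<G>) \<le> bicriteria_ratio \<alpha> \<epsilon> q * opt"
      by (simp add: bicriteria_ratio_def mult_ac)
    then show ?thesis using F G False by (simp add: greedy_invariant_def n_def b_def opt_def)
  qed
qed

text \<open>After \<open>card E\<close> rounds the first branch would require at least
  \<open>card E\<close> covered elements and yet fewer than (1 - \<epsilon>) q
  \<open>card E\<close>, although (1 - \<epsilon>) q \<le> 1.\<close>

lemma greedy_invariant_final:
  assumes inst: "smc_instance E \<S> c r" and \<epsilon>: "0 < \<epsilon>" "\<epsilon> < 1" and q: "0 < q" "q < 1"
    and inv: "greedy_invariant \<alpha> \<epsilon> q E \<S> c r (card E) \<F>" and feas: "psmc_feasible q E \<S> r \<noteq> {}"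
  shows "cost c \<F> \<le> bicriteria_ratio \<alpha> \<epsilon> q * psmc_opt q E \<S> c r"
    and "(1 - \<epsilon>) * q * real (card E) \<le> real (card (fully_covered E r \<F>))"
proof -
  have "(1 - \<epsilon>) * q \<le> 1 * 1" using \<epsilon> q by (intro mult_mono) auto
  then have "(1 - \<epsilon>) * q * real (card E) \<le> 1 * real (card E)" by (intro mult_right_mono) auto
  with inv feas show "(1 - \<epsilon>) * q * real (card E) \<le> real (card (fully_covered E r \<F>))"
    by (auto simp: greedy_invariant_def split: if_splits)
  with inv feas show "cost c \<F> \<le> bicriteria_ratio \<alpha> \<epsilon> q * psmc_opt q E \<S> c r"
    by (auto simp: greedy_invariant_def)
qed

section \<open>The greedy program\<close>

text \<open>The given program uses the variables \<open>0, \<dots>, k\<close>.\<close>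

abbreviation (input) gain_v :: "nat \<Rightarrow> nat" where "gain_v k \<equiv> k + 1" \<comment> \<open>\<open>(1 - \<epsilon>) q\<close>\<close>
abbreviation (input) reqs_v :: "nat \<Rightarrow> nat" where "reqs_v k \<equiv> k + 2"
abbreviation (input) rounds_v :: "nat \<Rightarrow> nat" where "rounds_v k \<equiv> k + 3" \<comment> \<open>as many entries as rounds to go\<close>
abbreviation (input) sets_v :: "nat \<Rightarrow> nat" where "sets_v k \<equiv> k + 4" \<comment> \<open>sets with selection bits, in reverse order\<close>
abbreviation (input) tmp_v :: "nat \<Rightarrow> nat" where "tmp_v k \<equiv> k + 5"
abbreviation (input) rows_v :: "nat \<Rightarrow> nat" where "rows_v k \<equiv> k + 6"
abbreviation (input) fwd_v :: "nat \<Rightarrow> nat" where "fwd_v k \<equiv> k + 7" \<comment> \<open>\<open>sets_v\<close> in forward order\<close>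
abbreviation (input) req_v :: "nat \<Rightarrow> nat" where "req_v k \<equiv> k + 8" \<comment> \<open>first requirements to process, later the residual ones\<close>
abbreviation (input) new_v :: "nat \<Rightarrow> nat" where "new_v k \<equiv> k + 9" \<comment> \<open>residual requirements, reversed\<close>
abbreviation (input) gap_v :: "nat \<Rightarrow> nat" where "gap_v k \<equiv> k + 10" \<comment> \<open>\<open>(1 - \<epsilon>) q\<close> times elements seen, minus covered elements seen\<close>
abbreviation (input) cols_v :: "nat \<Rightarrow> nat" where "cols_v k \<equiv> k + 11" \<comment> \<open>sets, restricted to the elements to process\<close>
abbreviation (input) next_v :: "nat \<Rightarrow> nat" where "next_v k \<equiv> k + 12"
abbreviation (input) count_v :: "nat \<Rightarrow> nat" where "count_v k \<equiv> k + 13"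
abbreviation (input) big_v :: "nat \<Rightarrow> nat" where "big_v k \<equiv> k + 14"

text \<open>Processes the first remaining element: mark times incidence bit indicates a selected set
  containing it. The bit is then dropped, so the next element comes first. Starting from 1,
  \<open>big_v\<close> ends as the unattainable requirement.\<close>

definition count_loop :: "nat \<Rightarrow> com" where
  "count_loop k = While (IsNum (Hd (Hd (Var (cols_v k)))))
     (Seq (Assign (count_v k) (Plus (Var (count_v k))
             (Times (Hd (Hd (Var (cols_v k)))) (Hd (Tl (Tl (Hd (Var (cols_v k)))))))))
     (Seq (Assign (next_v k) (ConsE (ConsE (Hd (Hd (Var (cols_v k))))
             (ConsE (Hd (Tl (Hd (Var (cols_v k))))) (Tl (Tl (Tl (Hd (Var (cols_v k))))))))
             (Var (next_v k))))
     (Seq (Assign (big_v k) (Plus (Var (big_v k)) (Const 1)))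
          (Assign (cols_v k) (Tl (Var (cols_v k)))))))"

text \<open>The sign of the final \<open>gap_v\<close> decides whether the threshold has been
  reached, so neither n nor the number of covered elements is computed separately.\<close>

definition req_loop :: "nat \<Rightarrow> com" where
  "req_loop k = While (IsNum (Hd (Var (req_v k))))
     (Seq (Assign (count_v k) (Const 0))
     (Seq (Assign (big_v k) (Const 1))
     (Seq (Assign (next_v k) NilE)
     (Seq (count_loop k)
     (Seq (Assign (cols_v k) (Var (next_v k)))
     (Seq (Assign (gap_v k) (Plus (Var (gap_v k)) (Var (gain_v k))))
     (Seq (If (Less (Var (count_v k)) (Hd (Var (req_v k))))
            (Assign (new_v k) (ConsE (Hd (Var (req_v k))) (Var (new_v k))))
            (Seq (Assign (new_v k) (ConsE (Var (big_v k)) (Var (new_v k))))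
                 (Assign (gap_v k) (Minus (Var (gap_v k)) (Const 1)))))
          (Assign (req_v k) (Tl (Var (req_v k)))))))))))"

text \<open>On 0/1 values, x + y - x y is disjunction, hence the mark of the union.\<close>

definition merge_loop :: "nat \<Rightarrow> com" where
  "merge_loop k = While (IsNum (Hd (Hd (Var (fwd_v k)))))
     (Seq (Assign (sets_v k) (ConsE
             (ConsE (Minus (Plus (Hd (Hd (Var (fwd_v k)))) (Hd (Var 0)))
                       (Times (Hd (Hd (Var (fwd_v k)))) (Hd (Var 0))))
                (Tl (Hd (Var (fwd_v k)))))
             (Var (sets_v k))))
     (Seq (Assign (fwd_v k) (Tl (Var (fwd_v k))))
          (Assign 0 (Tl (Var 0)))))"

definition residual_com :: "nat \<Rightarrow> com" where
  "residual_com k =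
     Seq (Assign (tmp_v k) (Var (sets_v k)))
     (Seq (Assign (rows_v k) NilE)
     (Seq (rev_map_loop (Hd (Hd (Var (tmp_v k)))) (tmp_v k)
            (ConsE (Times (Hd (Tl (Hd (Var (tmp_v k)))))
                      (Minus (Const 1) (Hd (Hd (Var (tmp_v k))))))
               (Tl (Tl (Hd (Var (tmp_v k))))))
            (rows_v k))
     (Seq (Assign (tmp_v k) (Var (sets_v k)))
     (Seq (Assign (fwd_v k) NilE)
     (Seq (rev_map_loop (Hd (Hd (Var (tmp_v k)))) (tmp_v k) (Hd (Var (tmp_v k))) (fwd_v k))
     (Seq (Assign (cols_v k) (Var (sets_v k)))
     (Seq (Assign (req_v k) (Var (reqs_v k)))
     (Seq (Assign (new_v k) NilE)
     (Seq (Assign (gap_v k) (Const 0))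
     (Seq (req_loop k)
          (rev_map_loop (Hd (Var (new_v k))) (new_v k) (Hd (Var (new_v k))) (req_v k))))))))))))"

text \<open>The self-assignment acts as an empty command once the threshold is reached.\<close>

definition round_com :: "nat \<Rightarrow> com \<Rightarrow> com" where
  "round_com k A =
     Seq (residual_com k)
       (If (Less (Const 0) (Var (gap_v k)))
         (Seq (Seq (clear k) (Seq (Assign 0 (ConsE (Var (req_v k)) (Var (rows_v k)))) A))
           (Seq (Assign (sets_v k) NilE) (merge_loop k)))
         (Assign (sets_v k) (Var (sets_v k))))"

text \<open>A copy of the requirement list serves as the clock of the outer loop, one round per
  element. All marks start at 0; the last loop restores the input order of the sets and outputs
  their marks.\<close>

definition greedy_com :: "real \<Rightarrow> nat \<Rightarrow> com \<Rightarrow> com" where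
  "greedy_com \<epsilon> k A =
     Seq (Assign (gain_v k) (Times (Const (1 - \<epsilon>)) (Hd (Var 0))))
     (Seq (Assign (reqs_v k) (Hd (Tl (Var 0))))
     (Seq (Assign (rounds_v k) (Var (reqs_v k)))
     (Seq (Assign (tmp_v k) (Tl (Tl (Var 0))))
     (Seq (rev_map_loop (Hd (Hd (Var (tmp_v k)))) (tmp_v k)
            (ConsE (Const 0) (Hd (Var (tmp_v k)))) (sets_v k))
     (Seq (While (IsNum (Hd (Var (rounds_v k))))
            (Seq (Assign (rounds_v k) (Tl (Var (rounds_v k)))) (round_com k A)))
     (Seq (Assign 0 NilE)
          (rev_map_loop (Hd (Hd (Var (sets_v k)))) (sets_v k) (Hd (Hd (Var (sets_v k)))) 0)))))))"

section \<open>Memory contents and the effect of the inner loops\<close>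

definition reqs_val :: "'a list \<Rightarrow> ('a \<Rightarrow> nat) \<Rightarrow> val" where
  "reqs_val es r = val_of_list (map (\<lambda>e. VNum (real (r e))) es)"

definition set_val :: "'a list \<Rightarrow> ('a set \<Rightarrow> real) \<Rightarrow> 'a set \<Rightarrow> val" where
  "set_val es c S = VCons (VNum (c S)) (val_of_bits (map (\<lambda>e. e \<in> S) es))"

definition marked_val :: "'a list \<Rightarrow> ('a set \<Rightarrow> real) \<Rightarrow> 'a set set \<Rightarrow> 'a set \<Rightarrow> val" where
  "marked_val es c \<F> S = VCons (VNum (of_bool (S \<in> \<F>))) (set_val es c S)"

lemma val_of_instance_alt:
  "val_of_instance es Ss c r = VCons (reqs_val es r) (val_of_list (map (set_val es c) Ss))"
  unfolding val_of_instance_def reqs_val_def set_val_def ..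

lemma count_loop:
  assumes "s (cols_v k) = val_of_list (map (marked_val (e # es) c \<F>) Zs)"
    and "s (count_v k) = VNum 0" "s (big_v k) = VNum 1" "s (next_v k) = VNil"
  shows "halts_within (count_loop k) s (Suc (5 * length Zs))
    (\<lambda>s'. s' (next_v k) = val_of_list (map (marked_val es c \<F>) (rev Zs)) \<and>
      s' (count_v k) = VNum (\<Sum>S\<leftarrow>Zs. of_bool (S \<in> \<F> \<and> e \<in> S)) \<and>
      s' (big_v k) = VNum (1 + real (length Zs)) \<and>
      (\<forall>x. x \<notin> {cols_v k, next_v k, count_v k, big_v k} \<longrightarrow> s' x = s x))"
proof -
  let ?I = "\<lambda>ys zs s'. s' (cols_v k) = val_of_list (map (marked_val (e # es) c \<F>) zs) \<and>
      s' (next_v k) = val_of_list (map (marked_val es c \<F>) (rev ys)) \<and>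
      s' (count_v k) = VNum (\<Sum>S\<leftarrow>ys. of_bool (S \<in> \<F> \<and> e \<in> S)) \<and>
      s' (big_v k) = VNum (1 + real (length ys)) \<and>
      (\<forall>x. x \<notin> {cols_v k, next_v k, count_v k, big_v k} \<longrightarrow> s' x = s x)"
  have "halts_within (count_loop k) s (Suc (length Zs * Suc 4)) (?I Zs [])"
    unfolding count_loop_def
    by (rule halts_within_While) (use assms in \<open>auto simp: marked_val_def[abs_def] set_val_def\<close>)
  then show ?thesis by (rule halts_within_mono) (auto simp: mult.commute)
qed

lemma merge_loop:
  assumes "s (fwd_v k) = val_of_list (map (marked_val es c \<F>) Ss)"
    and "s 0 = val_of_bits (map (\<lambda>S. S \<in> \<G>) Ss)" "s (sets_v k) = VNil"
  shows "halts_within (merge_loop k) s (Suc (4 * length Ss))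
    (\<lambda>s'. s' (sets_v k) = val_of_list (map (marked_val es c (\<F> \<union> \<G>)) (rev Ss)) \<and>
      (\<forall>x. x \<notin> {0, sets_v k, fwd_v k} \<longrightarrow> s' x = s x))"
proof -
  let ?I = "\<lambda>ys zs s'. s' (fwd_v k) = val_of_list (map (marked_val es c \<F>) zs) \<and>
      s' 0 = val_of_bits (map (\<lambda>S. S \<in> \<G>) zs) \<and>
      s' (sets_v k) = val_of_list (map (marked_val es c (\<F> \<union> \<G>)) (rev ys)) \<and>
      (\<forall>x. x \<notin> {0, sets_v k, fwd_v k} \<longrightarrow> s' x = s x)"
  have "halts_within (merge_loop k) s (Suc (length Ss * Suc 3)) (?I Ss [])"
    unfolding merge_loop_def
    by (rule halts_within_While) (use assms in \<open>auto simp: marked_val_def[abs_def]\<close>)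
  then show ?thesis by (rule halts_within_mono) (auto simp: mult.commute)
qed

text \<open>The value depends only on the set of entries, so the reversals caused by
  \<open>count_loop\<close> do not affect the count.\<close>

lemma sum_list_covering:
  assumes "distinct Zs" "\<F> \<subseteq> set Zs"
  shows "(\<Sum>S\<leftarrow>Zs. of_bool (S \<in> \<F> \<and> e \<in> S)) = real (card (covering \<F> e))"
proof -
  have "(\<Sum>S\<leftarrow>Zs. of_bool (S \<in> \<F> \<and> e \<in> S)) = (\<Sum>S\<in>set Zs. of_bool (S \<in> \<F> \<and> e \<in> S) :: real)"
    using assms(1) by (simp add: sum_list_distinct_conv_sum_set)
  also have "\<dots> = real (card (set Zs \<inter> {S. S \<in> \<F> \<and> e \<in> S}))" by (simp add: sum_of_bool_eq)
  also have "set Zs \<inter> {S. S \<in> \<F> \<and> e \<in> S} = covering \<F> e"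
    using assms(2) by (auto simp: covering_def)
  finally show ?thesis .
qed

lemma req_loop:
  assumes E: "set es = E" and Ss: "distinct Ss" "\<F> \<subseteq> set Ss"
    and s: "s (cols_v k) = val_of_list (map (marked_val es c \<F>) (rev Ss))"
      "s (req_v k) = reqs_val es r" "s (new_v k) = VNil" "s (gap_v k) = VNum 0"
      "s (gain_v k) = VNum g"
  shows "halts_within (req_loop k) s (Suc (length es * (5 * length Ss + 11)))
    (\<lambda>s'. s' (new_v k) = reqs_val (rev es) (residual_req E (set Ss) r \<F>) \<and>
      s' (req_v k) = VNil \<and>
      s' (gap_v k) = VNum (\<Sum>e\<leftarrow>es. g - of_bool (e \<in> fully_covered E r \<F>)) \<and>
      (\<forall>x. x \<notin> {req_v k, new_v k, gap_v k, cols_v k, next_v k, count_v k, big_v k}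
        \<longrightarrow> s' x = s x))"
proof -
  let ?X = "{req_v k, new_v k, gap_v k, cols_v k, next_v k, count_v k, big_v k}"
  let ?r = "residual_req E (set Ss) r \<F>"
  let ?g = "\<lambda>ys. \<Sum>e\<leftarrow>ys. g - of_bool (e \<in> fully_covered E r \<F>)"
  \<comment> \<open>Every pass of \<open>count_loop\<close> reverses the columns, so the invariant
    fixes their order only up to a permutation \<open>Zs\<close> of \<open>Ss\<close>.\<close>
  let ?I = "\<lambda>ys zs s'. (\<exists>Zs. distinct Zs \<and> set Zs = set Ss \<and> length Zs = length Ss \<and>
        s' (cols_v k) = val_of_list (map (marked_val zs c \<F>) Zs)) \<and>
      s' (req_v k) = reqs_val zs r \<and> s' (new_v k) = reqs_val (rev ys) ?r \<and>
      s' (gap_v k) = VNum (?g ys) \<and> (\<forall>x. x \<notin> ?X \<longrightarrow> s' x = s x)"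
  have "halts_within (req_loop k) s (Suc (length es * Suc (5 * length Ss + 10))) (?I es [])"
    unfolding req_loop_def
  proof (rule halts_within_While, goal_cases)
    case (1 ys e zs s')
    then obtain Zs where Zs: "distinct Zs" "set Zs = set Ss" "length Zs = length Ss"
      and cols: "s' (cols_v k) = val_of_list (map (marked_val (e # zs) c \<F>) Zs)"
      and req: "s' (req_v k) = VCons (VNum (real (r e))) (reqs_val zs r)"
      and new: "s' (new_v k) = reqs_val (rev ys) ?r" and gap: "s' (gap_v k) = VNum (?g ys)"
      and frame: "\<And>x. x \<notin> ?X \<Longrightarrow> s' x = s x"
      by (auto simp: reqs_val_def)
    have gain: "s' (gain_v k) = VNum g" using frame[of "gain_v k"] s by simp
    have e: "e \<in> fully_covered E r \<F> \<longleftrightarrow> r e \<le> card (covering \<F> e)"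
      using 1(1) E by (auto simp: fully_covered_def)
    have cnt: "(\<Sum>S\<leftarrow>Zs. of_bool (S \<in> \<F> \<and> e \<in> S)) = real (card (covering \<F> e))"
      using sum_list_covering[of Zs \<F> e] Zs Ss by simp
    \<comment> \<open>Identifies the final \<open>big_v\<close>, one plus the number of sets, with
      the \<open>Suc (card \<S>)\<close> of \<open>residual_req\<close>.\<close>
    have len: "length Ss = card (set Ss)" using Ss by (simp add: distinct_card)
    let ?s = "s'(count_v k := VNum 0, big_v k := VNum 1, next_v k := VNil)"
    have cl: "halts_within (count_loop k) ?s (Suc (5 * length Ss))
       (\<lambda>u. u (next_v k) = val_of_list (map (marked_val zs c \<F>) (rev Zs)) \<and>
        u (count_v k) = VNum (real (card (covering \<F> e))) \<and>
        u (big_v k) = VNum (1 + real (length Ss)) \<and>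
        (\<forall>x. x \<notin> {cols_v k, next_v k, count_v k, big_v k} \<longrightarrow> u x = ?s x))"
      using count_loop[of ?s k e zs c \<F> Zs] cols unfolding cnt Zs(3) by simp
    have "halts_within (Seq (count_loop k)
     (Seq (Assign (cols_v k) (Var (next_v k)))
     (Seq (Assign (gap_v k) (Plus (Var (gap_v k)) (Var (gain_v k))))
     (Seq (If (Less (Var (count_v k)) (Hd (Var (req_v k))))
            (Assign (new_v k) (ConsE (Hd (Var (req_v k))) (Var (new_v k))))
            (Seq (Assign (new_v k) (ConsE (Var (big_v k)) (Var (new_v k))))
                 (Assign (gap_v k) (Minus (Var (gap_v k)) (Const 1)))))
          (Assign (req_v k) (Tl (Var (req_v k)))))))) ?s (Suc (5 * length Ss) + 6)
       (?I (ys @ [e]) zs)"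
    proof (rule halts_within_Seq[OF cl], unfold halts_within_Seq_Assign, intro conjI, goal_cases)
      case (3 u)
      let ?u = "u(cols_v k := eval (Var (next_v k)) u)"
      let ?u = "?u(gap_v k := eval (Plus (Var (gap_v k)) (Var (gain_v k))) ?u)"
      let ?Q = "\<lambda>w. w (new_v k) = reqs_val (rev (ys @ [e])) ?r \<and> w (gap_v k) = VNum (?g (ys @ [e]))
        \<and> (\<forall>x. x \<notin> {new_v k, gap_v k} \<longrightarrow> w x = ?u x)"
      have "halts_within (If (Less (Var (count_v k)) (Hd (Var (req_v k))))
            (Assign (new_v k) (ConsE (Hd (Var (req_v k))) (Var (new_v k))))
            (Seq (Assign (new_v k) (ConsE (Var (big_v k)) (Var (new_v k))))
                 (Assign (gap_v k) (Minus (Var (gap_v k)) (Const 1))))) ?u (Suc 2) ?Q"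
        by (rule halts_within_If)
          (use 3 req new gap gain e len in \<open>auto simp: reqs_val_def residual_req_def\<close>)
      then have "halts_within (Seq (If (Less (Var (count_v k)) (Hd (Var (req_v k))))
            (Assign (new_v k) (ConsE (Hd (Var (req_v k))) (Var (new_v k))))
            (Seq (Assign (new_v k) (ConsE (Var (big_v k)) (Var (new_v k))))
                 (Assign (gap_v k) (Minus (Var (gap_v k)) (Const 1)))))
          (Assign (req_v k) (Tl (Var (req_v k))))) ?u (Suc 2 + 1) (?I (ys @ [e]) zs)"
      proof (rule halts_within_Seq, goal_cases)
        case (1 w)
        then show ?case using 3 req frame Zs by (auto intro!: exI[of _ "rev Zs"])
      qed
      then show ?case by (rule halts_within_mono) auto
    qed auto
    then show ?case using req by (simp add: eval_nat_numeral)
  qed (use s Ss in \<open>auto simp: reqs_val_def intro!: exI[of _ "rev Ss"]\<close>)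
  then show ?thesis by (rule halts_within_mono) (auto simp: reqs_val_def)
qed

lemma residual_com:
  assumes es: "distinct es" and Ss: "distinct Ss" "\<F> \<subseteq> set Ss"
    and s: "s (sets_v k) = val_of_list (map (marked_val es c \<F>) (rev Ss))"
      "s (reqs_v k) = reqs_val es r" "s (gain_v k) = VNum g"
  shows "halts_within (residual_com k) s
      (20 + 14 * length es + 6 * length Ss + 5 * length es * length Ss)
    (\<lambda>s'. s' (rows_v k) = val_of_list (map (set_val es (residual_cost c \<F>)) Ss) \<and>
      s' (fwd_v k) = val_of_list (map (marked_val es c \<F>) Ss) \<and>
      s' (req_v k) = reqs_val es (residual_req (set es) (set Ss) r \<F>) \<and>
      s' (gap_v k) = VNum (g * real (card (set es)) - real (card (fully_covered (set es) r \<F>))) \<and>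
      (\<forall>x \<in> {gain_v k, reqs_v k, rounds_v k, sets_v k}. s' x = s x))"
    (is "halts_within _ _ _ ?Q")
proof -
  let ?m = "length Ss" and ?n = "length es"
  let ?S = "val_of_list (map (marked_val es c \<F>) (rev Ss))"
  let ?R = "val_of_list (map (set_val es (residual_cost c \<F>)) Ss)"
  let ?F = "val_of_list (map (marked_val es c \<F>) Ss)"
  let ?r = "residual_req (set es) (set Ss) r \<F>"
  \<comment> \<open>The states up to the start of \<open>req_loop\<close> are known exactly, because
    \<open>rev_map_loop\<close> determines its final state; \<open>req_loop\<close> leaves its
    scratch variables unspecified.\<close>
  let ?s1 = "s(tmp_v k := ?S, rows_v k := VNil)"
  let ?s2 = "?s1(tmp_v k := VNil, rows_v k := ?R)"
  let ?s3 = "?s2(tmp_v k := ?S, fwd_v k := VNil)"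
  let ?s4 = "?s3(tmp_v k := VNil, fwd_v k := ?F)"
  let ?s5 = "?s4(cols_v k := ?S, req_v k := reqs_val es r, new_v k := VNil, gap_v k := VNum 0)"
  let ?loop1 = "rev_map_loop (Hd (Hd (Var (tmp_v k)))) (tmp_v k)
            (ConsE (Times (Hd (Tl (Hd (Var (tmp_v k)))))
                      (Minus (Const 1) (Hd (Hd (Var (tmp_v k))))))
               (Tl (Tl (Hd (Var (tmp_v k))))))
            (rows_v k)"
  let ?loop2 = "rev_map_loop (Hd (Hd (Var (tmp_v k)))) (tmp_v k) (Hd (Var (tmp_v k))) (fwd_v k)"
  let ?loop4 = "rev_map_loop (Hd (Var (new_v k))) (new_v k) (Hd (Var (new_v k))) (req_v k)"
  have 1: "halts_within ?loop1 ?s1 (Suc (3 * ?m)) (\<lambda>s'. s' = ?s2)"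
    using rev_map_loop[of "tmp_v k" "rows_v k" ?s1 "marked_val es c \<F>" "rev Ss"
        "Hd (Hd (Var (tmp_v k)))" _ "set_val es (residual_cost c \<F>)"]
    by (simp add: marked_val_def set_val_def residual_cost_def)
  have 2: "halts_within ?loop2 ?s3 (Suc (3 * ?m)) (\<lambda>s'. s' = ?s4)"
    using rev_map_loop[of "tmp_v k" "fwd_v k" ?s3 "marked_val es c \<F>" "rev Ss"
        "Hd (Hd (Var (tmp_v k)))" "Hd (Var (tmp_v k))" "marked_val es c \<F>"]
    by (simp add: marked_val_def)
  have gap: "(\<Sum>e\<leftarrow>es. g - of_bool (e \<in> fully_covered (set es) r \<F>))
      = g * real (card (set es)) - real (card (fully_covered (set es) r \<F>))"
  proof -
    have "(\<Sum>e\<leftarrow>es. g - of_bool (e \<in> fully_covered (set es) r \<F>))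
        = (\<Sum>e\<in>set es. g - of_bool (e \<in> fully_covered (set es) r \<F>))"
      using es by (simp add: sum_list_distinct_conv_sum_set)
    also have "\<dots> = g * real (card (set es)) - real (card (set es \<inter> fully_covered (set es) r \<F>))"
      by (simp add: sum_subtractf sum_of_bool_eq)
    also have "set es \<inter> fully_covered (set es) r \<F> = fully_covered (set es) r \<F>"
      by (auto simp: fully_covered_def)
    finally show ?thesis .
  qed
  have 3: "halts_within (Seq (req_loop k) ?loop4) ?s5
      (Suc (?n * (5 * ?m + 11)) + Suc (3 * ?n)) ?Q"
  proof (rule halts_within_Seq[OF req_loop[OF refl Ss, of _ k es c r g]], goal_cases)
    case (6 s')
    have "halts_within ?loop4 s' (Suc (3 * ?n))
      (\<lambda>u. u = s'(new_v k := VNil, req_v k := reqs_val es ?r))"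
      using rev_map_loop[of "new_v k" "req_v k" s' "\<lambda>e. VNum (real (?r e))" "rev es"
        "Hd (Var (new_v k))" "Hd (Var (new_v k))" "\<lambda>e. VNum (real (?r e))"] 6
      by (simp add: reqs_val_def)
    then show ?case by (rule halts_within_mono) (use 6 gap s in auto)
  qed (use s in auto)
  let ?D = "Seq ?loop2
     (Seq (Assign (cols_v k) (Var (sets_v k)))
     (Seq (Assign (req_v k) (Var (reqs_v k)))
     (Seq (Assign (new_v k) NilE)
     (Seq (Assign (gap_v k) (Const 0))
     (Seq (req_loop k) ?loop4)))))"
  let ?T = "Suc (3 * ?m) + (4 + (Suc (?n * (5 * ?m + 11)) + Suc (3 * ?n)))"
  have 4: "halts_within ?D ?s3 ?T ?Q"
    by (rule halts_within_Seq[OF 2]) (use 3 s in \<open>simp add: eval_nat_numeral\<close>)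
  have "halts_within (Seq ?loop1
     (Seq (Assign (tmp_v k) (Var (sets_v k)))
     (Seq (Assign (fwd_v k) NilE) ?D))) ?s1 (Suc (3 * ?m) + (2 + ?T)) ?Q"
    by (rule halts_within_Seq[OF 1]) (use 4 s in simp)
  then have "halts_within (residual_com k) s (2 + (Suc (3 * ?m) + (2 + ?T))) ?Q"
    unfolding residual_com_def using s by simp
  then show ?thesis by (rule halts_within_mono) (simp_all add: algebra_simps)
qed

section \<open>Characteristic vectors and input sizes\<close>

lemma map_mem_selected:
  assumes "distinct Ss" "length bs = length Ss"
  shows "map (\<lambda>S. S \<in> selected Ss bs) Ss = bs"
proof (rule nth_equalityI)
  fix i assume "i < length (map (\<lambda>S. S \<in> selected Ss bs) Ss)"
  then show "map (\<lambda>S. S \<in> selected Ss bs) Ss ! i = bs ! i"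
    using assms by (auto simp: selected_def nth_eq_iff_index_eq)
qed (simp add: assms)

lemma selected_map_mem:
  assumes "\<F> \<subseteq> set Ss"
  shows "selected Ss (map (\<lambda>S. S \<in> \<F>) Ss) = \<F>"
proof
  show "selected Ss (map (\<lambda>S. S \<in> \<F>) Ss) \<subseteq> \<F>" by (auto simp: selected_def)
  show "\<F> \<subseteq> selected Ss (map (\<lambda>S. S \<in> \<F>) Ss)"
  proof
    fix S assume "S \<in> \<F>"
    moreover from this assms obtain i where "i < length Ss" "Ss ! i = S"
      by (metis in_set_conv_nth subsetD)
    ultimately show "S \<in> selected Ss (map (\<lambda>S. S \<in> \<F>) Ss)"
      unfolding selected_def by force
  qed
qed

lemma selected_subset: "selected Ss bs \<subseteq> set Ss"
  by (auto simp: selected_def)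

lemma val_size_list: "val_size (val_of_list vs) = 1 + (\<Sum>v\<leftarrow>vs. 1 + val_size v)"
  by (induction vs) auto

lemma val_size_bits: "val_size (val_of_bits bs) = 1 + 2 * length bs"
  by (induction bs) auto

text \<open>Only the two lengths enter. All residual instances are therefore as large as the
  original one, and a single time bound serves every call.\<close>

lemma val_size_instance:
  "val_size (val_of_instance es Ss c r) =
     3 + 2 * length es + length Ss * (4 + 2 * length es)"
  by (simp add: val_of_instance_def val_size_list val_size_bits comp_def sum_list_triv algebra_simps)

lemma poly_nat_mono:
  fixes p :: "nat poly"
  assumes "x \<le> y"
  shows "poly p x \<le> poly p y"
  using assms by (induction p) (auto intro: add_mono mult_mono)

section \<open>Correctness and running time of a round and of the whole program\<close>

lemma round_com:
  assumes A: "com_vars A \<subseteq> {..k}"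
    and alg: "\<exists>t bs. runs A (val_of_instance es Ss (residual_cost c \<F>)
          (residual_req (set es) (set Ss) r \<F>)) t (val_of_bits bs) \<and> t \<le> T \<and>
        length bs = length Ss \<and> P (selected Ss bs)"
    and es: "distinct es" and Ss: "distinct Ss" "\<F> \<subseteq> set Ss"
    and s: "s (sets_v k) = val_of_list (map (marked_val es c \<F>) (rev Ss))"
      "s (reqs_v k) = reqs_val es r" "s (gain_v k) = VNum g"
  shows "halts_within (round_com k A) s
      (25 + k + T + 14 * length es + 10 * length Ss + 5 * length es * length Ss)
    (\<lambda>s'. (\<exists>\<G>. s' (sets_v k) = val_of_list (map (marked_val es c \<G>) (rev Ss)) \<and>
        (if real (card (fully_covered (set es) r \<F>)) < g * real (card (set es))
         then \<exists>\<H>. \<G> = \<F> \<union> \<H> \<and> \<H> \<subseteq> set Ss \<and> P \<H> else \<G> = \<F>)) \<and>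
      (\<forall>x \<in> {gain_v k, reqs_v k, rounds_v k}. s' x = s x))"
    (is "halts_within _ _ _ ?Q")
proof -
  let ?n = "length es" and ?m = "length Ss"
  \<comment> \<open>The summands are the residual phase, the threshold test, the call, and the reset
    with the merge. The predicate \<open>P\<close> is only carried along; it will be the density
    guarantee.\<close>
  have "halts_within (round_com k A) s ((20 + 14 * ?n + 6 * ?m + 5 * ?n * ?m) +
      Suc ((Suc k + Suc T) + (1 + Suc (4 * ?m)))) ?Q"
    unfolding round_com_def
  proof (rule halts_within_Seq[OF residual_com[OF es Ss s]], rule halts_within_If, goal_cases)
    case (1 s')
    from alg obtain t bs where bs: "runs A (val_of_instance es Ss (residual_cost c \<F>)
          (residual_req (set es) (set Ss) r \<F>)) t (val_of_bits bs)" "t \<le> T"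
        "length bs = length Ss" "P (selected Ss bs)" by blast
    let ?H = "selected Ss bs"
    have "halts_within (Seq (clear k) (Seq (Assign 0 (ConsE (Var (req_v k)) (Var (rows_v k)))) A))
        s' (Suc k + Suc t) (\<lambda>u. u 0 = val_of_bits bs \<and> (\<forall>x>k. u x = s' x))"
      by (rule halts_within_call[OF bs(1) A]) (use 1 in \<open>auto simp: val_of_instance_alt\<close>)
    then have call: "halts_within (Seq (clear k)
        (Seq (Assign 0 (ConsE (Var (req_v k)) (Var (rows_v k)))) A))
        s' (Suc k + Suc T) (\<lambda>u. u 0 = val_of_bits bs \<and> (\<forall>x>k. u x = s' x))"
      by (rule halts_within_mono) (use bs(2) in auto)
    show ?case
    proof (rule halts_within_Seq[OF call])
      fix u assume u: "u 0 = val_of_bits bs \<and> (\<forall>x>k. u x = s' x)"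
      \<comment> \<open>The call may have overwritten any variable up to \<open>k\<close>, but the
        old marks in \<open>fwd_v\<close> lie above. As \<open>Ss\<close> is distinct, the returned
        bits are exactly membership in \<open>?H\<close>.\<close>
      have "halts_within (merge_loop k) (u(sets_v k := VNil)) (Suc (4 * ?m)) ?Q"
      proof (rule halts_within_mono[OF merge_loop[of _ k es c \<F> Ss ?H]], goal_cases)
        case (5 w)
        then have "w (sets_v k) = val_of_list (map (marked_val es c (\<F> \<union> ?H)) (rev Ss))"
          "\<forall>x \<in> {gain_v k, reqs_v k, rounds_v k}. w x = s x"
          using 1(1) u by auto
        moreover have "real (card (fully_covered (set es) r \<F>)) < g * real (card (set es))"
          using 1 by simp
        ultimately show ?case using selected_subset bs(4) by (intro conjI exI[of _ "\<F> \<union> ?H"]) auto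
      qed (use 1(1) u map_mem_selected[OF Ss(1) bs(3)] in auto)
      then show "halts_within (Seq (Assign (sets_v k) NilE) (merge_loop k)) u
          (1 + Suc (4 * ?m)) ?Q" by simp
    qed
  next
    case (2 s')
    then show ?case using s by (auto intro!: exI[of _ \<F>])
  qed
  then show ?thesis by (rule halts_within_mono) simp_all
qed

text \<open>In the loop invariant the number of processed entries is the round counter of
  \<open>greedy_invariant\<close>. At the end it equals the size of the ground set, since
  \<open>es\<close> is distinct.\<close>

lemma greedy_com:
  assumes A: "com_vars A \<subseteq> {..k}"
    and alg: "\<And>c' r'. smc_instance (set es) (set Ss) c' r' \<Longrightarrow>
      \<exists>t bs. runs A (val_of_instance es Ss c' r') t (val_of_bits bs) \<and> t \<le> T \<and>
        length bs = length Ss \<and>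
        density (set es) c' r' (selected Ss bs) \<le> ereal \<alpha> * min_density (set es) (set Ss) c' r'"
    and \<alpha>: "1 \<le> \<alpha>" and \<epsilon>: "0 < \<epsilon>" "\<epsilon> < 1" and q: "0 < q" "q < 1"
    and es: "distinct es" and Ss: "distinct Ss" and inst: "smc_instance (set es) (set Ss) c r"
  defines "U \<equiv> 27 + k + T + 14 * length es + 10 * length Ss + 5 * length es * length Ss"
  shows "\<exists>t \<F>. runs (greedy_com \<epsilon> k A) (VCons (VNum q) (val_of_instance es Ss c r)) t
      (val_of_bits (map (\<lambda>S. S \<in> \<F>) Ss)) \<and>
    t \<le> 8 + 6 * length Ss + length es * U \<and>
    greedy_invariant \<alpha> \<epsilon> q (set es) (set Ss) c r (card (set es)) \<F>"
proof -
  let ?n = "length es" and ?m = "length Ss" and ?g = "(1 - \<epsilon>) * q"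
  let ?inv = "greedy_invariant \<alpha> \<epsilon> q (set es) (set Ss) c r"
  let ?s0 = "(\<lambda>_. VNil)(0 := VCons (VNum q) (val_of_instance es Ss c r))"
  let ?s1 = "?s0(gain_v k := VNum ?g, reqs_v k := reqs_val es r, rounds_v k := reqs_val es r,
      tmp_v k := val_of_list (map (set_val es c) Ss))"
  let ?s2 = "?s1(tmp_v k := VNil, sets_v k := val_of_list (map (marked_val es c {}) (rev Ss)))"
  let ?loop1 = "rev_map_loop (Hd (Hd (Var (tmp_v k)))) (tmp_v k)
            (ConsE (Const 0) (Hd (Var (tmp_v k)))) (sets_v k)"
  let ?loop2 = "While (IsNum (Hd (Var (rounds_v k))))
            (Seq (Assign (rounds_v k) (Tl (Var (rounds_v k)))) (round_com k A))"
  let ?loop3 = "rev_map_loop (Hd (Hd (Var (sets_v k)))) (sets_v k) (Hd (Hd (Var (sets_v k)))) 0"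
  let ?Q = "\<lambda>s'. \<exists>\<F>. s' 0 = val_of_bits (map (\<lambda>S. S \<in> \<F>) Ss) \<and> ?inv (card (set es)) \<F>"
  let ?I = "\<lambda>ys zs s'. s' (gain_v k) = VNum ?g \<and> s' (reqs_v k) = reqs_val es r \<and>
      s' (rounds_v k) = reqs_val zs r \<and>
      (\<exists>\<F>. s' (sets_v k) = val_of_list (map (marked_val es c \<F>) (rev Ss)) \<and> ?inv (length ys) \<F>)"
  have 1: "halts_within ?loop1 ?s1 (Suc (3 * ?m)) (\<lambda>s'. s' = ?s2)"
    using rev_map_loop[of "tmp_v k" "sets_v k" ?s1 "set_val es c" Ss
        "Hd (Hd (Var (tmp_v k)))" "ConsE (Const 0) (Hd (Var (tmp_v k)))" "marked_val es c {}"]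
    by (simp add: marked_val_def set_val_def)
  have 2: "halts_within ?loop2 ?s2 (Suc (?n * Suc (U - 1))) (?I es [])"
  proof (rule halts_within_While[where I = ?I], goal_cases)
    case (1 ys e zs s)
    then obtain \<F> where F: "s (sets_v k) = val_of_list (map (marked_val es c \<F>) (rev Ss))"
      "?inv (length ys) \<F>" by blast
    let ?s = "s(rounds_v k := reqs_val zs r)"
    let ?P = "\<lambda>\<H>. density (set es) (residual_cost c \<F>) (residual_req (set es) (set Ss) r \<F>) \<H>
      \<le> ereal \<alpha> * min_density (set es) (set Ss) (residual_cost c \<F>) (residual_req (set es) (set Ss) r \<F>)"
    have sub: "\<F> \<subseteq> set Ss" using F(2) by (simp add: greedy_invariant_def)
    \<comment> \<open>The residual instance lives on the same \<open>es\<close> and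
      \<open>Ss\<close>, so the assumption on \<open>A\<close> applies with the same
      \<open>T\<close>.\<close>
    have "halts_within (round_com k A) ?s (25 + k + T + 14 * ?n + 10 * ?m + 5 * ?n * ?m)
        (?I (ys @ [e]) zs)"
    proof (rule halts_within_mono[OF round_com[OF A alg es Ss sub, of c r ?s ?g]], goal_cases)
      case (6 w)
      then obtain \<G> where G: "w (sets_v k) = val_of_list (map (marked_val es c \<G>) (rev Ss))"
        "if real (card (fully_covered (set es) r \<F>)) < ?g * real (card (set es))
         then \<exists>\<H>. \<G> = \<F> \<union> \<H> \<and> \<H> \<subseteq> set Ss \<and> ?P \<H> else \<G> = \<F>" by blast
      have "?inv (Suc (length ys)) \<G>"
      proof (cases "real (card (fully_covered (set es) r \<F>)) < ?g * real (card (set es))")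
        case True
        with G(2) obtain \<H> where "\<G> = \<F> \<union> \<H>" "\<H> \<subseteq> set Ss" "?P \<H>" by auto
        with greedy_invariant_step[OF inst \<alpha> \<epsilon> q F(2) True] show ?thesis by blast
      next
        case False
        with G(2) greedy_invariant_skip[OF F(2) False] show ?thesis by simp
      qed
      then show ?case using 6 1 G(1) by auto
    qed (use 1 F smc_instance_residual[OF inst] in auto)
    \<comment> \<open>The two remaining steps of \<open>U\<close> pay for the loop test and for
      shortening \<open>rounds_v\<close>.\<close>
    then have round: "halts_within (round_com k A) ?s (U - 2) (?I (ys @ [e]) zs)"
      by (rule halts_within_mono) (simp_all add: U_def)
    have "s (rounds_v k) = VCons (VNum (real (r e))) (reqs_val zs r)"
      using 1(2) by (simp add: reqs_val_def)
    moreover have "1 \<le> U - 1" "U - 1 - 1 = U - 2" by (simp_all add: U_def)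
    ultimately show ?case using round
      by (simp only: halts_within_Seq_Assign eval.simps holds.simps val_hd.simps val_tl.simps) simp
  next
    case (2 s)
    then show ?case by (simp add: reqs_val_def)
  next
    case 3
    then show ?case using greedy_invariant_start[OF inst _ \<epsilon> q] \<alpha> by auto
  qed
  have 3: "halts_within (Seq (Assign 0 NilE) ?loop3) s (1 + Suc (3 * ?m)) ?Q" if "?I es [] s" for s
  proof -
    from that obtain \<F> where F: "s (sets_v k) = val_of_list (map (marked_val es c \<F>) (rev Ss))"
      "?inv (length es) \<F>" by blast
    have "halts_within ?loop3 (s(0 := VNil)) (Suc (3 * ?m)) (\<lambda>s'. s' = s(0 := VNil,
        sets_v k := VNil, 0 := val_of_list (map (\<lambda>S. VNum (of_bool (S \<in> \<F>))) Ss)))"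
      using rev_map_loop[of "sets_v k" 0 "s(0 := VNil)" "marked_val es c \<F>" "rev Ss"
        "Hd (Hd (Var (sets_v k)))" "Hd (Hd (Var (sets_v k)))" "\<lambda>S. VNum (of_bool (S \<in> \<F>))"] F
      by (simp add: marked_val_def)
    then have "halts_within ?loop3 (s(0 := VNil)) (Suc (3 * ?m)) ?Q"
      by (rule halts_within_mono) (use F(2) es in
        \<open>auto simp: val_of_bits_def distinct_card comp_def intro!: exI[of _ \<F>]\<close>)
    then show ?thesis by simp
  qed
  have 4: "halts_within (Seq ?loop2 (Seq (Assign 0 NilE) ?loop3)) ?s2
      (Suc (?n * Suc (U - 1)) + (1 + Suc (3 * ?m))) ?Q"
    by (rule halts_within_Seq[OF 2]) (rule 3)
  have "halts_within (Seq ?loop1 (Seq ?loop2 (Seq (Assign 0 NilE) ?loop3))) ?s1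
      (Suc (3 * ?m) + (Suc (?n * Suc (U - 1)) + (1 + Suc (3 * ?m)))) ?Q"
    by (rule halts_within_Seq[OF 1]) (use 4 in simp)
  then have 5: "halts_within (Seq ?loop1 (Seq ?loop2 (Seq (Assign 0 NilE) ?loop3))) ?s1
      (4 + 6 * ?m + ?n * U) ?Q"
    by (rule halts_within_mono) (simp_all add: U_def)
  define X where "X = 4 + 6 * ?m + ?n * U"
  have "halts_within (greedy_com \<epsilon> k A) ?s0 (4 + X) ?Q"
    using 5 unfolding greedy_com_def X_def[symmetric] by (simp add: val_of_instance_alt)
  then have "halts_within (greedy_com \<epsilon> k A) ?s0 (8 + 6 * ?m + ?n * U) ?Q"
    by (rule halts_within_mono) (simp_all add: X_def)
  then show ?thesis unfolding halts_within_def runs_def by blast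
qed

section \<open>The bicriteria algorithm and its polynomial time bound\<close>

theorem theorem2:
  fixes \<alpha> :: real
  assumes "\<exists>A. MDSC_approx_alg \<alpha> A"
  shows "\<forall>\<epsilon>::real. 0 < \<epsilon> \<and> \<epsilon> < 1 \<longrightarrow>
    (\<exists>B. PSMC_bicriteria_alg (\<lambda>q. \<alpha> * (1 + ln (1 / \<epsilon>) + (1 - q) / (\<epsilon> * q))) (1 - \<epsilon>) B)"
proof (intro allI impI, elim conjE)
  fix \<epsilon> :: real assume \<epsilon>: "0 < \<epsilon>" "\<epsilon> < 1"
  from assms obtain A where A: "MDSC_approx_alg \<alpha> A" ..
  note \<alpha> = MDSC_approx_ratio_ge_1[OF A]
  from A obtain p :: "nat poly" where p: "\<And>(es :: nat list) Ss c r.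
      distinct es \<Longrightarrow> distinct Ss \<Longrightarrow> smc_instance (set es) (set Ss) c r \<Longrightarrow>
        \<exists>t bs. runs A (val_of_instance es Ss c r) t (val_of_bits bs) \<and>
           t \<le> poly p (val_size (val_of_instance es Ss c r)) \<and> length bs = length Ss \<and>
           density (set es) c r (selected Ss bs)
             \<le> ereal \<alpha> * min_density (set es) (set Ss) c r"
    unfolding MDSC_approx_alg_def by blast
  obtain k where k: "com_vars A \<subseteq> {..k}"
    using finite_com_vars[of A] finite_nat_set_iff_bounded_le by (metis atMost_iff subsetI)
  \<comment> \<open>The step bound of \<open>greedy_com\<close> with both lengths replaced by the
    input size N and \<open>T\<close> by \<open>poly p N\<close>; the second summand is N times
    \<open>p\<close>. The number \<open>k\<close> depends only on \<open>A\<close>, so it is a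
    constant here.\<close>
  let ?p = "[:8, 33 + k, 24, 5:] + [:0, 1:] * p"
  have "PSMC_bicriteria_alg (bicriteria_ratio \<alpha> \<epsilon>) (1 - \<epsilon>) (greedy_com \<epsilon> k A)"
    unfolding PSMC_bicriteria_alg_def
  proof (rule exI[of _ ?p], intro allI impI, elim conjE)
    fix q :: real and es :: "nat list" and Ss c r
    assume q: "0 < q" "q < 1" and es: "distinct es" and Ss: "distinct Ss"
      and inst: "smc_instance (set es) (set Ss) c r"
    let ?v = "VCons (VNum q) (val_of_instance es Ss c r)"
    let ?n = "length es" and ?m = "length Ss"
    define N where "N = val_size ?v"
    define T where "T = poly p (3 + 2 * ?n + ?m * (4 + 2 * ?n))"
    have alg: "\<exists>t bs. runs A (val_of_instance es Ss c' r') t (val_of_bits bs) \<and> t \<le> T \<and>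
        length bs = length Ss \<and>
        density (set es) c' r' (selected Ss bs) \<le> ereal \<alpha> * min_density (set es) (set Ss) c' r'"
      if "smc_instance (set es) (set Ss) c' r'" for c' r'
      using p[OF es Ss that] unfolding val_size_instance T_def .
    from greedy_com[OF k alg \<alpha> \<epsilon> q es Ss inst] obtain t \<F>
      where run: "runs (greedy_com \<epsilon> k A) ?v t (val_of_bits (map (\<lambda>S. S \<in> \<F>) Ss))"
        and t: "t \<le> 8 + 6 * ?m + ?n * (27 + k + T + 14 * ?n + 10 * ?m + 5 * ?n * ?m)"
        and inv: "greedy_invariant \<alpha> \<epsilon> q (set es) (set Ss) c r (card (set es)) \<F>" by blast
    have N: "N = 5 + 2 * ?n + ?m * (4 + 2 * ?n)" by (simp add: N_def val_size_instance)
    then have nN: "?n \<le> N" and mN: "?m \<le> N" by (auto simp: algebra_simps)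
    have TN: "T \<le> poly p N" unfolding T_def by (rule poly_nat_mono) (simp add: N)
    have "t \<le> 8 + 6 * N + N * (27 + k + poly p N + 14 * N + 10 * N + 5 * N * N)"
      using nN mN TN by (intro order_trans[OF t] add_mono mult_mono) auto
    also have "\<dots> = poly ?p N" by (simp add: algebra_simps power2_eq_square)
    finally have time: "t \<le> poly ?p (val_size ?v)" unfolding N_def .
    have sel: "selected Ss (map (\<lambda>S. S \<in> \<F>) Ss) = \<F>"
      by (rule selected_map_mem) (use inv in \<open>simp add: greedy_invariant_def\<close>)
    show "\<exists>t bs. runs (greedy_com \<epsilon> k A) ?v t (val_of_bits bs) \<and> t \<le> poly ?p (val_size ?v) \<and>
        length bs = length Ss \<and>
        (psmc_feasible q (set es) (set Ss) r \<noteq> {} \<longrightarrow>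
           cost c (selected Ss bs) \<le> bicriteria_ratio \<alpha> \<epsilon> q * psmc_opt q (set es) (set Ss) c r \<and>
           (1 - \<epsilon>) * q * real (card (set es))
             \<le> real (card (fully_covered (set es) r (selected Ss bs))))"
      using run time greedy_invariant_final[OF inst \<epsilon> q inv]
      by (intro exI[of _ t] exI[of _ "map (\<lambda>S. S \<in> \<F>) Ss"]) (simp add: sel)
  qed
  then show "\<exists>B. PSMC_bicriteria_alg
      (\<lambda>q. \<alpha> * (1 + ln (1 / \<epsilon>) + (1 - q) / (\<epsilon> * q))) (1 - \<epsilon>) B"
    unfolding bicriteria_ratio_def[abs_def] by blast
qed

end
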